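(* Assume (L1)-(L3), (R1)-(R2) and $(\Lambda)$ (all stated in the context). Let $t_0>0$, let $u^\dagger\in\operatorname{argmin} d_0$ and assume that $\lambda(t_0)\,\|u^\dagger\|\le \gamma\varrho^{q-1}/q$. Let $\alpha\ge 3$ and let the pair $(x(\cdot),u(\cdot))$ be a solution of the inertial dual diagonal dynamic, with datum $\bar y$, in the following sense: - $u\in\mathcal C^1([t_0,+\infty[,\mathcal Y)$ and $x(t)=\nabla R^*(-A^*u(t))$ for all $t\ge t_0$; - for every $T>t_0$, the functions $\dot u$ and $t\mapsto d_{\lambda(t)}(u(t))$ are absolutely continuous on $[t_0,T]$; - for a.e. $t\in[t_0,+\infty[$, $\;-\ddot u(t)-\frac{\alpha}{t}\dot u(t)\in\partial d_{\lambda(t)}(u(t))$. Then there exists a constant $C\in\,]0,+\infty[$ such that for all $t>t_0$ $$ d_{\lambda(t)}(u(t))-\inf d_0\le \frac{C}{t^2}\qquad\text{and}\qquad \|x(t)-x^\dagger\|\le\frac{\sqrt{2C}}{\sqrt{\sigma}\,t}.$$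
   Context: $\mathcal X,\mathcal Y$ are real Hilbert spaces, $A:\mathcal X\to\mathcal Y$ is a bounded linear operator with adjoint $A^*$, and $\bar y\in\mathcal Y$ is the datum of the inverse problem "find $\bar x$ with $A\bar x=\bar y$". $\Gamma_0(\mathcal H)$ is the set of proper, convex, lower semicontinuous functions $\mathcal H\to\,]-\infty,+\infty]$; $f\in\Gamma_0(\mathcal H)$ is $\sigma$-strongly convex if $f-\frac\sigma2\|\cdot\|^2\in\Gamma_0(\mathcal H)$. $\partial f$ is the convex subdifferential and $f^*(u)=\sup_x\{\langle u,x\rangle-f(x)\}$ the Fenchel conjugate. $\mathbb B(y,\varrho)$ is the open ball ($\mathbb B(y,+\infty)=\mathcal Y$). $\ell:\mathcal Y\times\mathcal Y\to\mathbb R\cup\{+\infty\}$ is a data-fit function, $\ell_y:=\ell(\cdot,y)$, and $\ell_y^*$ is the Fenchel conjugate of $\ell_y$. $R:\mathcal X\to\,]-\infty,+\infty]$ is the regularizer. $x^\dagger$ denotes the solution (unique by strong convexity of $R$) of: minimize $R(x)$ subject to $x\in\operatorname{argmin}_{x'\in\mathcal X}\ell(Ax',\bar y)$. Assumptions: (L1) for all $y\in\mathcal Y$, $\ell_y\in\Gamma_0(\mathcal Y)$ and $\ell_y$ is coercive (tends to $+\infty$ as the norm of its argument tends to $+\infty$). (L2) for all $y_1,y_2\in\mathcal Y$: $\ell(y_1,y_2)=0\iff y_1=y_2$. (L3) there exist $q\in[1,+\infty[$, $\varrho\in\,]0,+\infty]$, $\gamma\in\,]0,+\infty[$ such that $\frac\gamma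 q\|y-\bar y\|^q\le\ell(y,\bar y)$ for all $y\in\mathbb B(\bar y,\varrho)$. These $q,\varrho,\gamma$ are fixed. (R1) $R$ is $\sigma$-strongly convex with $\sigma\in\,]0,+\infty[$ (so $R^*$ is differentiable on $\mathcal X$). (R2) $\partial R(x^\dagger)\cap\operatorname{Im}A^*\neq\emptyset$. $(\Lambda)$ $\lambda:[0,+\infty[\,\to\,]0,+\infty[$ is non-increasing and differentiable with $\lim_{t\to\infty}\lambda(t)=0$; moreover, if $q>1$, $\int_{t_0}^{+\infty}t\,\lambda(t)^{1/(q-1)}\,dt<+\infty$. Dual functions: for $\lambda>0$ and $u\in\mathcal Y$, $d_\lambda(u):=R^*(-A^*u)+\frac1\lambda\ell_{\bar y}^*(\lambda u)$, and $d_0(u):=R^*(-A^*u)+\langle\bar y,u\rangle$. Convention: $\varrho^{q-1}=1$ if $q=1$, and $\varrho^{q-1}=+\infty$ if $\varrho=+\infty$ and $q>1$. *)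

theory Defs
  imports "HOL-Analysis.Analysis"
begin

section \<open>Convex analysis for extended-real-valued functions\<close>

text \<open>Real Hilbert spaces are types of sort \<open>{real_inner, complete_space}\<close>; functions with values
  in \<open>]-\<infinity>, +\<infinity>]\<close> are functions into \<^typ>\<open>ereal\<close> that never take the value \<open>-\<infinity>\<close>.\<close>

definition proper_fun :: "('a \<Rightarrow> ereal) \<Rightarrow> bool" where
  "proper_fun f \<longleftrightarrow> (\<forall>x. f x \<noteq> -\<infinity>) \<and> (\<exists>x. f x \<noteq> \<infinity>)"

text \<open>For functions avoiding \<open>-\<infinity>\<close> the right-hand side is never of the form \<open>\<infinity> - \<infinity>\<close>, and at the
  end points \<open>t = 0, 1\<close> the convention \<open>0 * \<infinity> = 0\<close> makes the inequality trivial.\<close>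

definition convex_fun :: "('a::real_vector \<Rightarrow> ereal) \<Rightarrow> bool" where
  "convex_fun f \<longleftrightarrow> (\<forall>x y. \<forall>t\<in>{0..1::real}.
     f ((1 - t) *\<^sub>R x + t *\<^sub>R y) \<le> ereal (1 - t) * f x + ereal t * f y)"

definition lsc_fun :: "('a::topological_space \<Rightarrow> ereal) \<Rightarrow> bool" where
  "lsc_fun f \<longleftrightarrow> (\<forall>x. f x \<le> Liminf (at x) f)"

definition Gamma0 :: "('a::real_normed_vector \<Rightarrow> ereal) set" where
  "Gamma0 = {f. proper_fun f \<and> convex_fun f \<and> lsc_fun f}"

definition strongly_convex_fun :: "real \<Rightarrow> ('a::real_normed_vector \<Rightarrow> ereal) \<Rightarrow> bool" where
  "strongly_convex_fun \<sigma> f \<longleftrightarrow> (\<lambda>x. f x - ereal (\<sigma> / 2 * (norm x)\<^sup>2)) \<in> Gamma0"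

definition coercive_fun :: "('a::real_normed_vector \<Rightarrow> ereal) \<Rightarrow> bool" where
  "coercive_fun f \<longleftrightarrow> (f \<longlongrightarrow> \<infinity>) at_infinity"

definition fenchel_conj :: "('a::real_inner \<Rightarrow> ereal) \<Rightarrow> 'a \<Rightarrow> ereal" where
  "fenchel_conj f u = (SUP x. ereal (u \<bullet> x) - f x)"

text \<open>The subdifferential is empty at points where \<open>f\<close> is not finite, as is automatic for proper \<open>f\<close>.\<close>

definition subdiff :: "('a::real_inner \<Rightarrow> ereal) \<Rightarrow> 'a \<Rightarrow> 'a set" where
  "subdiff f x = {v. \<bar>f x\<bar> \<noteq> \<infinity> \<and> (\<forall>y. f x + ereal (v \<bullet> (y - x)) \<le> f y)}"

text \<open>\<open>has_gradient f x g\<close> means that \<open>f\<close> is finite near \<open>x\<close>, Frechet differentiable at \<open>x\<close>, and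
  \<open>\<nabla> f x = g\<close>.\<close>

definition has_gradient :: "('a::real_inner \<Rightarrow> ereal) \<Rightarrow> 'a \<Rightarrow> 'a \<Rightarrow> bool" where
  "has_gradient f x g \<longleftrightarrow>
     (\<forall>\<^sub>F z in nhds x. \<bar>f z\<bar> \<noteq> \<infinity>) \<and> GDERIV (\<lambda>z. real_of_ereal (f z)) x :> g"

definition argmin_on :: "('a \<Rightarrow> ereal) \<Rightarrow> 'a set \<Rightarrow> 'a set" where
  "argmin_on f S = {x. is_arg_min f (\<lambda>x. x \<in> S) x}"

section \<open>Absolute continuity on a compact interval\<close>

definition abs_continuous_on :: "real \<Rightarrow> real \<Rightarrow> (real \<Rightarrow> 'a::real_normed_vector) \<Rightarrow> bool" where
  "abs_continuous_on a b f \<longleftrightarrow>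
     (\<forall>\<epsilon>>0. \<exists>\<delta>>0. \<forall>(n::nat) (l::nat \<Rightarrow> real) (r::nat \<Rightarrow> real).
        (\<forall>i<n. a \<le> l i \<and> l i \<le> r i \<and> r i \<le> b) \<and>
        (\<forall>i<n. \<forall>j<n. i \<noteq> j \<longrightarrow> {l i<..<r i} \<inter> {l j<..<r j} = {}) \<and>
        (\<Sum>i<n. r i - l i) < \<delta>
        \<longrightarrow> (\<Sum>i<n. norm (f (r i) - f (l i))) < \<epsilon>)"

section \<open>Dual functions and the inertial dual diagonal dynamic\<close>

text \<open>\<open>dual_diag\<close> is \<open>d_lam\<close> (meant for \<open>lam > 0\<close>) and \<open>dual_lim\<close> is \<open>d_0\<close>.  The data-fit function
  is curried, so that \<open>l_y\<close> is \<open>\<lambda>z. l z y\<close>.\<close>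

definition dual_diag ::
  "('x::real_inner \<Rightarrow> 'y::real_inner) \<Rightarrow> ('x \<Rightarrow> ereal) \<Rightarrow> ('y \<Rightarrow> 'y \<Rightarrow> ereal) \<Rightarrow> 'y
    \<Rightarrow> real \<Rightarrow> 'y \<Rightarrow> ereal" where
  "dual_diag A R l ybar lam u =
     fenchel_conj R (- adjoint A u) + ereal (1 / lam) * fenchel_conj (\<lambda>z. l z ybar) (lam *\<^sub>R u)"

definition dual_lim ::
  "('x::real_inner \<Rightarrow> 'y::real_inner) \<Rightarrow> ('x \<Rightarrow> ereal) \<Rightarrow> 'y \<Rightarrow> 'y \<Rightarrow> ereal" where
  "dual_lim A R ybar u = fenchel_conj R (- adjoint A u) + ereal (ybar \<bullet> u)"

text \<open>\<open>radius_pow \<rho> q\<close> is \<open>\<rho>^(q-1)\<close> for \<open>\<rho> \<in> ]0, +\<infinity>]\<close> and \<open>q \<ge> 1\<close>.\<close>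

definition radius_pow :: "ereal \<Rightarrow> real \<Rightarrow> ereal" where
  "radius_pow \<rho> q =
     (if q = 1 then 1 else if \<rho> = \<infinity> then \<infinity> else ereal (real_of_ereal \<rho> powr (q - 1)))"

text \<open>Derivatives are taken within \<open>[t0, +\<infinity>[\<close>, hence one-sided at \<open>t0\<close>; \<open>u'\<close> is the derivative of \<open>u\<close>
  there, and the differential inclusion includes the existence of the second derivative at almost
  every \<open>t\<close>.  The values of \<open>u\<close> and \<open>x\<close> before \<open>t0\<close> are irrelevant.  Absolute continuity of
  \<open>t \<mapsto> d_lam(t) (u t)\<close> comprises its finiteness.\<close>

definition inertial_dual_diagonal_solution ::
  "('x::real_inner \<Rightarrow> 'y::real_inner) \<Rightarrow> ('x \<Rightarrow> ereal) \<Rightarrow> ('y \<Rightarrow> 'y \<Rightarrow> ereal) \<Rightarrow> 'y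
    \<Rightarrow> (real \<Rightarrow> real) \<Rightarrow> real \<Rightarrow> real \<Rightarrow> (real \<Rightarrow> 'x) \<Rightarrow> (real \<Rightarrow> 'y) \<Rightarrow> bool" where
  "inertial_dual_diagonal_solution A R l ybar lam \<alpha> t0 x u \<longleftrightarrow>
     (\<exists>u'. (\<forall>t\<ge>t0. (u has_vector_derivative u' t) (at t within {t0..})) \<and>
           continuous_on {t0..} u' \<and>
           (\<forall>t\<ge>t0. has_gradient (fenchel_conj R) (- adjoint A (u t)) (x t)) \<and>
           (\<forall>T>t0. abs_continuous_on t0 T u') \<and>
           (\<forall>t\<ge>t0. \<bar>dual_diag A R l ybar (lam t) (u t)\<bar> \<noteq> \<infinity>) \<and>
           (\<forall>T>t0. abs_continuous_on t0 T
              (\<lambda>t. real_of_ereal (dual_diag A R l ybar (lam t) (u t)))) \<and>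
           (AE t in lborel. t \<ge> t0 \<longrightarrow>
              (\<exists>u''. (u' has_vector_derivative u'') (at t within {t0..}) \<and>
                     - u'' - (\<alpha> / t) *\<^sub>R u' t \<in> subdiff (dual_diag A R l ybar (lam t)) (u t))))"

end

theory Submission
  imports Defs
begin

text \<open>The minimality of \<open>udag\<close> for \<open>d_0\<close> forces \<open>A z = ybar\<close> for the maximiser \<open>z\<close> in
  \<open>R\<^sup>*(- A\<^sup>* udag)\<close>; hence \<open>z = xdag\<close>, \<open>inf d_0 = - R(xdag)\<close>, and strong convexity gives
  \<open>\<sigma>/2 \<parallel>x(t) - xdag\<parallel>\<^sup>2 \<le> d_0(u(t)) - inf d_0 \<le> d_lam(t)(u(t)) - inf d_0\<close>.
  The growth condition on \<open>l\<close> bounds \<open>d_lam(t)(udag) - d_0(udag)\<close> by \<open>e(t) = K lam(t)\<^bsup>1/(q-1)\<^esup>\<close>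
  (by \<open>0\<close> if \<open>q = 1\<close>), and \<open>t e(t)\<close> is integrable. Since \<open>d_lam\<close> decreases with \<open>lam\<close>, the Lyapunov function
  \<open>t\<^sup>2 (d_lam(t)(u(t)) - inf d_0) + \<parallel>(\<alpha> - 1) (u(t) - udag) + t u'(t)\<parallel>\<^sup>2 / 2\<close> grows at a rate
  of at most \<open>(\<alpha> - 1) t e(t)\<close> almost everywhere. To avoid a.e. differentiability of absolutely
  continuous functions, this rate is only stated for difference quotients to the left.\<close>

section \<open>Absolutely continuous functions\<close>

lemma abs_continuous_onE:
  assumes "abs_continuous_on a b f" "0 < \<epsilon>"
  obtains \<delta> where "\<delta> > 0"
    "\<And>(n::nat) l r. \<lbrakk>\<And>i. i < n \<Longrightarrow> a \<le> l i \<and> l i \<le> r i \<and> r i \<le> b;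
      \<And>i j. \<lbrakk>i < n; j < n; i \<noteq> j\<rbrakk> \<Longrightarrow> {l i<..<r i} \<inter> {l j<..<r j} = {};
      (\<Sum>i<n. r i - l i) < \<delta>\<rbrakk> \<Longrightarrow> (\<Sum>i<n. norm (f (r i) - f (l i))) < \<epsilon>"
proof -
  obtain \<delta> where \<delta>: "\<delta> > 0" and H: "\<forall>(n::nat) l r.
      (\<forall>i<n. a \<le> l i \<and> l i \<le> r i \<and> r i \<le> b) \<and>
      (\<forall>i<n. \<forall>j<n. i \<noteq> j \<longrightarrow> {l i<..<r i} \<inter> {l j<..<r j} = {}) \<and>
      (\<Sum>i<n. r i - l i) < \<delta> \<longrightarrow> (\<Sum>i<n. norm (f (r i) - f (l i))) < \<epsilon>"
    using assms(1)[unfolded abs_continuous_on_def, rule_format, OF assms(2)] by blast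
  show thesis
    by (rule that[OF \<delta>], rule H[rule_format]) (intro conjI allI impI; assumption?; simp)
qed

text \<open>Sums, differences, bilinear products and C1 functions are all treated through this
  comparison of increments.\<close>

lemma abs_continuous_on_dominated:
  fixes f :: "real \<Rightarrow> 'a::real_normed_vector" and g :: "real \<Rightarrow> 'b::real_normed_vector"
    and h :: "real \<Rightarrow> 'c::real_normed_vector"
  assumes f: "abs_continuous_on a b f" and g: "abs_continuous_on a b g"
    and bound: "\<And>s t. \<lbrakk>a \<le> s; s \<le> t; t \<le> b\<rbrakk>
      \<Longrightarrow> norm (h t - h s) \<le> K * (norm (f t - f s) + norm (g t - g s))"
  shows "abs_continuous_on a b h"
  unfolding abs_continuous_on_def
proof (intro allI impI)
  fix \<epsilon> :: real assume "\<epsilon> > 0"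
  \<comment> \<open>\<open>K\<close> may be zero or negative, so \<open>M\<close> is a positive
    bound above it; each of the two sums of increments gets the share
    \<open>\<epsilon> / (2 * M)\<close>.\<close>
  define M where "M = \<bar>K\<bar> + 1"
  have M: "M > 0" "K \<le> M" by (auto simp: M_def)
  have e: "\<epsilon> / (2 * M) > 0" using M \<open>\<epsilon> > 0\<close> by simp
  obtain \<delta>1 where d1: "\<delta>1 > 0" and f1: "\<And>(n::nat) l r. \<lbrakk>\<And>i. i < n \<Longrightarrow> a \<le> l i \<and> l i \<le> r i \<and> r i \<le> b;
      \<And>i j. \<lbrakk>i < n; j < n; i \<noteq> j\<rbrakk> \<Longrightarrow> {l i<..<r i} \<inter> {l j<..<r j} = {};
      (\<Sum>i<n. r i - l i) < \<delta>1\<rbrakk> \<Longrightarrow> (\<Sum>i<n. norm (f (r i) - f (l i))) < \<epsilon> / (2 * M)"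
    using abs_continuous_onE[OF f e] by blast
  obtain \<delta>2 where d2: "\<delta>2 > 0" and g1: "\<And>(n::nat) l r. \<lbrakk>\<And>i. i < n \<Longrightarrow> a \<le> l i \<and> l i \<le> r i \<and> r i \<le> b;
      \<And>i j. \<lbrakk>i < n; j < n; i \<noteq> j\<rbrakk> \<Longrightarrow> {l i<..<r i} \<inter> {l j<..<r j} = {};
      (\<Sum>i<n. r i - l i) < \<delta>2\<rbrakk> \<Longrightarrow> (\<Sum>i<n. norm (g (r i) - g (l i))) < \<epsilon> / (2 * M)"
    using abs_continuous_onE[OF g e] by blast
  have "(\<Sum>i<n. norm (h (r i) - h (l i))) < \<epsilon>"
    if lr: "\<forall>i<n. a \<le> l i \<and> l i \<le> r i \<and> r i \<le> b"
      and disj: "\<forall>i<n. \<forall>j<n. i \<noteq> j \<longrightarrow> {l i<..<r i} \<inter> {l j<..<r j} = {}"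
      and len: "(\<Sum>i<n. r i - l i) < min \<delta>1 \<delta>2" for n :: nat and l r
  proof -
    have "(\<Sum>i<n. norm (h (r i) - h (l i)))
        \<le> (\<Sum>i<n. M * (norm (f (r i) - f (l i)) + norm (g (r i) - g (l i))))"
    proof (rule sum_mono)
      fix i assume "i \<in> {..<n}"
      then have "norm (h (r i) - h (l i)) \<le> K * (norm (f (r i) - f (l i)) + norm (g (r i) - g (l i)))"
        using lr by (intro bound) auto
      also have "\<dots> \<le> M * (norm (f (r i) - f (l i)) + norm (g (r i) - g (l i)))"
        using M by (intro mult_right_mono) auto
      finally show "norm (h (r i) - h (l i)) \<le> M * (norm (f (r i) - f (l i)) + norm (g (r i) - g (l i)))" .
    qed
    also have "\<dots> = M * ((\<Sum>i<n. norm (f (r i) - f (l i))) + (\<Sum>i<n. norm (g (r i) - g (l i))))"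
      by (simp only: sum_distrib_left[symmetric] sum.distrib)
    also have "\<dots> < M * (\<epsilon> / (2 * M) + \<epsilon> / (2 * M))"
    proof (intro mult_strict_left_mono add_strict_mono \<open>M > 0\<close>)
      show "(\<Sum>i<n. norm (f (r i) - f (l i))) < \<epsilon> / (2 * M)"
        using lr disj len by (intro f1) auto
      show "(\<Sum>i<n. norm (g (r i) - g (l i))) < \<epsilon> / (2 * M)"
        using lr disj len by (intro g1) auto
    qed
    also have "\<dots> = \<epsilon>" using M by (simp add: field_simps)
    finally show ?thesis .
  qed
  then show "\<exists>\<delta>>0. \<forall>(n::nat) l r. (\<forall>i<n. a \<le> l i \<and> l i \<le> r i \<and> r i \<le> b) \<and>
      (\<forall>i<n. \<forall>j<n. i \<noteq> j \<longrightarrow> {l i<..<r i} \<inter> {l j<..<r j} = {}) \<and>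
      (\<Sum>i<n. r i - l i) < \<delta> \<longrightarrow> (\<Sum>i<n. norm (h (r i) - h (l i))) < \<epsilon>"
    using d1 d2 by (intro exI[of _ "min \<delta>1 \<delta>2"]) auto
qed

lemma abs_continuous_on_id: "abs_continuous_on a b (\<lambda>t. t)"
  unfolding abs_continuous_on_def
proof (intro allI impI)
  fix \<epsilon> :: real assume "\<epsilon> > 0"
  have "(\<Sum>i<n. norm (r i - l i)) < \<epsilon>"
    if "\<forall>i<n. a \<le> l i \<and> l i \<le> r i \<and> r i \<le> b" "(\<Sum>i<n. r i - l i) < \<epsilon>" for n :: nat and l r
  proof -
    have "(\<Sum>i<n. norm (r i - l i)) = (\<Sum>i<n. r i - l i)"
      using that(1) by (intro sum.cong) auto
    then show ?thesis using that(2) by simp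
  qed
  then show "\<exists>\<delta>>0. \<forall>(n::nat) l r. (\<forall>i<n. a \<le> l i \<and> l i \<le> r i \<and> r i \<le> b) \<and>
      (\<forall>i<n. \<forall>j<n. i \<noteq> j \<longrightarrow> {l i<..<r i} \<inter> {l j<..<r j} = {}) \<and>
      (\<Sum>i<n. r i - l i) < \<delta> \<longrightarrow> (\<Sum>i<n. norm (r i - l i)) < \<epsilon>"
    using \<open>\<epsilon> > 0\<close> by blast
qed

lemma abs_continuous_on_imp_continuous_on:
  assumes "abs_continuous_on a b f"
  shows "continuous_on {a..b} f"
  unfolding continuous_on_iff
proof (intro ballI allI impI)
  fix t and \<epsilon> :: real assume t: "t \<in> {a..b}" and "\<epsilon> > 0"
  obtain \<delta> where \<delta>: "\<delta> > 0" and small: "\<And>(n::nat) l r. \<lbrakk>\<And>i. i < n \<Longrightarrow> a \<le> l i \<and> l i \<le> r i \<and> r i \<le> b;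
      \<And>i j. \<lbrakk>i < n; j < n; i \<noteq> j\<rbrakk> \<Longrightarrow> {l i<..<r i} \<inter> {l j<..<r j} = {};
      (\<Sum>i<n. r i - l i) < \<delta>\<rbrakk> \<Longrightarrow> (\<Sum>i<n. norm (f (r i) - f (l i))) < \<epsilon>"
    using abs_continuous_onE[OF assms \<open>\<epsilon> > 0\<close>] by blast
  have "dist (f s) (f t) < \<epsilon>" if "s \<in> {a..b}" "dist s t < \<delta>" for s
  proof -
    \<comment> \<open>A family consisting of a single interval is enough; \<open>min\<close> and
      \<open>max\<close> put its end points in order.\<close>
    have "norm (f (max s t) - f (min s t)) < \<epsilon>"
      using small[of 1 "\<lambda>_. min s t" "\<lambda>_. max s t"] that t by (auto simp: dist_real_def)
    then show ?thesis
      by (cases "s \<le> t") (auto simp: dist_norm norm_minus_commute max_def min_def)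
  qed
  then show "\<exists>d>0. \<forall>s\<in>{a..b}. dist s t < d \<longrightarrow> dist (f s) (f t) < \<epsilon>"
    using \<delta> by blast
qed

lemma abs_continuous_on_add:
  assumes "abs_continuous_on a b f" "abs_continuous_on a b g"
  shows "abs_continuous_on a b (\<lambda>t. f t + g t)"
  using assms
  by (rule abs_continuous_on_dominated[where K = 1]) (simp add: add_diff_add norm_triangle_ineq)

lemma abs_continuous_on_diff:
  assumes "abs_continuous_on a b f" "abs_continuous_on a b g"
  shows "abs_continuous_on a b (\<lambda>t. f t - g t)"
  using assms
proof (rule abs_continuous_on_dominated[where K = 1])
  fix s t
  have "f t - g t - (f s - g s) = (f t - f s) - (g t - g s)" by simp
  then show "norm (f t - g t - (f s - g s)) \<le> 1 * (norm (f t - f s) + norm (g t - g s))"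
    using norm_triangle_ineq4[of "f t - f s" "g t - g s"] by (simp only: mult_1)
qed

lemma abs_continuous_on_const: "abs_continuous_on a b (\<lambda>_. c)"
  by (rule abs_continuous_on_dominated[OF abs_continuous_on_id abs_continuous_on_id, where K = 1]) simp

text \<open>Both factors are continuous, hence bounded on the compact interval, and the increment of
  the product splits into one increment per factor.\<close>

lemma (in bounded_bilinear) abs_continuous_on:
  assumes f: "abs_continuous_on s t f" and g: "abs_continuous_on s t g"
  shows "abs_continuous_on s t (\<lambda>r. prod (f r) (g r))"
proof -
  have "bounded (f ` {s..t})" "bounded (g ` {s..t})"
    using f g by (auto intro!: compact_imp_bounded compact_continuous_image
        abs_continuous_on_imp_continuous_on)
  then obtain Bf Bg where Bf: "\<And>r. r \<in> {s..t} \<Longrightarrow> norm (f r) \<le> Bf"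
    and Bg: "\<And>r. r \<in> {s..t} \<Longrightarrow> norm (g r) \<le> Bg"
    unfolding bounded_iff by blast
  obtain K where K: "0 < K" "\<And>a b. norm (prod a b) \<le> norm a * norm b * K"
    using pos_bounded by blast
  define M where "M = \<bar>Bf\<bar> + \<bar>Bg\<bar>"
  show ?thesis
  proof (rule abs_continuous_on_dominated[OF f g, where K = "K * M"])
    fix r1 r2 assume r: "s \<le> r1" "r1 \<le> r2" "r2 \<le> t"
    have M: "norm (f r1) \<le> M" "norm (g r2) \<le> M"
      using Bf[of r1] Bg[of r2] r by (auto simp: M_def)
    have "prod (f r2) (g r2) - prod (f r1) (g r1) = prod (f r2 - f r1) (g r2) + prod (f r1) (g r2 - g r1)"
      by (simp add: diff_left diff_right)
    then have "norm (prod (f r2) (g r2) - prod (f r1) (g r1))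
      \<le> norm (f r2 - f r1) * norm (g r2) * K + norm (f r1) * norm (g r2 - g r1) * K"
      using norm_triangle_mono[OF K(2) K(2)] by metis
    also have "\<dots> \<le> norm (f r2 - f r1) * M * K + M * norm (g r2 - g r1) * K"
      using M K by (intro add_mono mult_right_mono mult_left_mono) auto
    finally show "norm (prod (f r2) (g r2) - prod (f r1) (g r1))
        \<le> K * M * (norm (f r2 - f r1) + norm (g r2 - g r1))"
      by (simp add: algebra_simps)
  qed
qed

text \<open>By the mean value inequality \<open>f\<close> is Lipschitz, with a bound of
  \<open>f'\<close> as constant; the identity then dominates it.\<close>

lemma C1_imp_abs_continuous_on:
  fixes f :: "real \<Rightarrow> 'a::real_normed_vector"
  assumes der: "\<And>t. t \<in> {a..b} \<Longrightarrow> (f has_vector_derivative f' t) (at t within {a..b})"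
    and cont: "continuous_on {a..b} f'"
  shows "abs_continuous_on a b f"
proof -
  have "bounded (f' ` {a..b})"
    using cont by (intro compact_imp_bounded compact_continuous_image) auto
  then obtain B where B: "\<And>t. t \<in> {a..b} \<Longrightarrow> norm (f' t) \<le> B"
    unfolding bounded_iff by blast
  show ?thesis
  proof (rule abs_continuous_on_dominated[OF abs_continuous_on_id abs_continuous_on_id, where K = B])
    fix s t assume st: "a \<le> s" "s \<le> t" "t \<le> b"
    have "norm (f t - f s) \<le> B * norm (t - s)"
    proof (rule differentiable_bound[of "{a..b}" f "\<lambda>x h. h *\<^sub>R f' x"])
      show "onorm (\<lambda>h. h *\<^sub>R f' x) \<le> B" if "x \<in> {a..b}" for x
      proof (rule onorm_le)
        show "norm (h *\<^sub>R f' x) \<le> B * norm h" for h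
          using mult_right_mono[OF B[OF that], of "\<bar>h\<bar>"] by (simp add: mult.commute)
      qed
    qed (use der st in \<open>auto simp: has_vector_derivative_def\<close>)
    moreover have B0: "0 \<le> B" using order_trans[OF norm_ge_zero B[of s]] st by simp
    moreover have "0 \<le> B * norm (t - s)" using B0 by simp
    ultimately show "norm (f t - f s) \<le> B * (norm (t - s) + norm (t - s))"
      unfolding distrib_left by linarith
  qed
qed

text \<open>Continuous induction leftwards from \<open>b\<close>: the exceptional null set is covered by an open set
  \<open>U\<close> of small measure, and \<open>V s\<close>, the variation of \<open>f\<close> inside \<open>U \<inter> [s, b]\<close>, absorbs the
  increments over \<open>U\<close>. Only increments to the left of a point are controlled, so a Cousin-type
  covering by two-sided neighbourhoods is not available.\<close>

lemma abs_continuous_on_AE_left_decreasing: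
  fixes f :: "real \<Rightarrow> real"
  assumes ac: "abs_continuous_on a b f" and "a \<le> b"
    and AE: "AE t in lborel. a < t \<longrightarrow> t \<le> b \<longrightarrow>
      (\<forall>\<epsilon>>0. \<forall>\<^sub>F s in at_left t. f t - f s \<le> \<epsilon> * (t - s))"
  shows "f b \<le> f a"
proof (rule field_le_epsilon)
  fix e :: real assume "e > 0"
  \<comment> \<open>The choice makes \<open>\<epsilon> * (b - a) + \<epsilon> = e\<close>; the
    second summand pays for the exceptional set.\<close>
  define \<epsilon> where "\<epsilon> = e / (b - a + 1)"
  have \<epsilon>: "\<epsilon> > 0" using \<open>e > 0\<close> \<open>a \<le> b\<close> by (simp add: \<epsilon>_def)
  obtain \<delta> where \<delta>: "\<delta> > 0" and small: "\<And>(n::nat) l r. \<lbrakk>\<And>i. i < n \<Longrightarrow> a \<le> l i \<and> l i \<le> r i \<and> r i \<le> b;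
      \<And>i j. \<lbrakk>i < n; j < n; i \<noteq> j\<rbrakk> \<Longrightarrow> {l i<..<r i} \<inter> {l j<..<r j} = {};
      (\<Sum>i<n. r i - l i) < \<delta>\<rbrakk> \<Longrightarrow> (\<Sum>i<n. norm (f (r i) - f (l i))) < \<epsilon>"
    using abs_continuous_onE[OF ac \<epsilon>] by blast
  obtain N where N: "N \<in> null_sets lborel"
    and good: "\<And>t. \<lbrakk>t \<notin> N; a < t; t \<le> b\<rbrakk> \<Longrightarrow> \<forall>\<^sub>F s in at_left t. f t - f s \<le> \<epsilon> * (t - s)"
    using AE \<epsilon> by (auto elim!: AE_E3)
  have "N \<in> sets lebesgue" using N by (auto simp: null_sets_def)
  \<comment> \<open>\<open>N\<close> is null, so outer regularity gives an open \<open>U\<close>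
    around it whose measure is below the \<open>\<delta>\<close> of absolute continuity.\<close>
  then obtain U where U: "open U" "N \<subseteq> U" "U - N \<in> lmeasurable" "emeasure lebesgue (U - N) < ennreal \<delta>"
    using sets_lebesgue_outer_open[OF _ \<delta>] by metis
  have N': "N \<in> null_sets lebesgue"
    using N by (rule null_sets_completionI)
  have Um: "U \<in> lmeasurable" and Ue: "measure lebesgue U < \<delta>"
  proof -
    have eq: "emeasure lebesgue U = emeasure lebesgue (U - N)"
      using emeasure_Diff_null_set[OF N', of U] U(1) by simp
    then show m: "U \<in> lmeasurable"
      using U by (intro fmeasurableI) (auto simp: top.extremum_strict less_top intro: less_trans)
    have "emeasure lebesgue U = ennreal (measure lebesgue U)"
      using m by (simp add: emeasure_eq_measure2)
    then show "measure lebesgue U < \<delta>"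
      using eq U(4) \<delta> by (metis ennreal_less_iff measure_nonneg)
  qed
  define ivs where "ivs s n l r \<longleftrightarrow> (\<forall>i<n. s \<le> l i \<and> l i \<le> r i \<and> r i \<le> b \<and> {l i<..<r i} \<subseteq> U) \<and>
      (\<forall>i<n. \<forall>j<n. i \<noteq> j \<longrightarrow> {l i<..<r i} \<inter> {l j<..<r j} = {})"
    for s and n :: nat and l r :: "nat \<Rightarrow> real"
  define W where "W s = {\<Sum>i<n. \<bar>f (r i) - f (l i)\<bar> |n l r. ivs s n l r}" for s
  define V where "V s = Sup (W s)" for s
  \<comment> \<open>Disjointness turns the total length into the measure of a subset of
    \<open>U\<close>, which is below \<open>\<delta>\<close>.\<close>
  have W_bound: "w \<le> \<epsilon>" if wW: "w \<in> W s" and "a \<le> s" for w s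
  proof -
    obtain n l r where w: "w = (\<Sum>i<n. \<bar>f (r i) - f (l i)\<bar>)" and iv: "ivs s n l r"
      using wW by (auto simp: W_def)
    have "(\<Sum>i<n. r i - l i) = (\<Sum>i<n. measure lebesgue {l i<..<r i})"
      using iv by (intro sum.cong) (auto simp: ivs_def)
    also have "\<dots> = measure lebesgue (\<Union>i<n. {l i<..<r i})"
      using iv by (intro measure_UNION'[symmetric]) (auto simp: ivs_def pairwise_def disjnt_def)
    also have "\<dots> \<le> measure lebesgue U"
      using iv Um by (intro measure_mono_fmeasurable) (auto simp: ivs_def)
    finally have "(\<Sum>i<n. norm (f (r i) - f (l i))) < \<epsilon>"
      using iv Ue \<open>a \<le> s\<close> by (intro small) (auto simp: ivs_def intro: order_trans)
    then show ?thesis using w by simp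
  qed
  have W_bdd: "bdd_above (W s)" if "a \<le> s" for s
    using W_bound that by (intro bdd_aboveI) blast
  have W0: "0 \<in> W s" for s
    unfolding W_def ivs_def by (rule CollectI, rule exI[of _ 0]) auto
  have V_bound: "V s \<le> \<epsilon>" if "a \<le> s" for s
    unfolding V_def using W0 W_bound that by (intro cSup_least) blast+
  have V_nonneg: "0 \<le> V s" if "a \<le> s" for s
    unfolding V_def using W0 W_bdd that by (intro cSup_upper) auto
  have V_mono: "V t \<le> V s" if "a \<le> s" "s \<le> t" for s t
    unfolding V_def
  proof (rule cSup_subset_mono)
    have "ivs s n l r" if "ivs t n l r" for n l r
      using that \<open>s \<le> t\<close> unfolding ivs_def by (meson order_trans)
    then show "W t \<subseteq> W s" unfolding W_def by blast
  qed (use W0 W_bdd that in auto)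
  \<comment> \<open>The interval from \<open>s\<close> to \<open>t\<close> is appended at index
    \<open>n\<close> to a family lying to the right of \<open>t\<close>, so disjointness is
    preserved.\<close>
  have V_step: "V t + \<bar>f t - f s\<bar> \<le> V s"
    if st: "a \<le> s" "s \<le> t" "t \<le> b" and sub: "{s<..<t} \<subseteq> U" for s t
  proof -
    have "w \<le> V s - \<bar>f t - f s\<bar>" if wW: "w \<in> W t" for w
    proof -
      obtain n l r where w: "w = (\<Sum>i<n. \<bar>f (r i) - f (l i)\<bar>)" and iv: "ivs t n l r"
        using wW by (auto simp: W_def)
      define l' where "l' = l(n := s)"
      define r' where "r' = r(n := t)"
      have old: "t \<le> l i" "l i \<le> r i" "r i \<le> b" "{l i<..<r i} \<subseteq> U" if "i < n" for i
        using iv that unfolding ivs_def by blast+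
      have "s \<le> l' i \<and> l' i \<le> r' i \<and> r' i \<le> b \<and> {l' i<..<r' i} \<subseteq> U" if "i < Suc n" for i
      proof (cases "i = n")
        case True
        then show ?thesis using st sub by (simp add: l'_def r'_def)
      next
        case False
        then have "i < n" using that by simp
        then show ?thesis using old[of i] st False by (simp add: l'_def r'_def)
      qed
      moreover have "{l' i<..<r' i} \<inter> {l' j<..<r' j} = {}" if ij: "i < Suc n" "j < Suc n" "i \<noteq> j" for i j
      proof -
        consider "i < n" "j < n" | "i < n" "j = n" | "i = n" "j < n" using ij by linarith
        then show ?thesis
        proof cases
          case 1
          then have "{l i<..<r i} \<inter> {l j<..<r j} = {}" using iv ij unfolding ivs_def by blast
          then show ?thesis using 1 by (simp add: l'_def r'_def)
        next
          case 2
          then show ?thesis using old[of i] by (auto simp: l'_def r'_def)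
        next
          case 3
          then show ?thesis using old[of j] by (auto simp: l'_def r'_def)
        qed
      qed
      ultimately have "ivs s (Suc n) l' r'" unfolding ivs_def by blast
      moreover have "w + \<bar>f t - f s\<bar> = (\<Sum>i<Suc n. \<bar>f (r' i) - f (l' i)\<bar>)"
        by (simp add: w l'_def r'_def)
      ultimately have "w + \<bar>f t - f s\<bar> \<in> W s"
        unfolding W_def by blast
      then have "w + \<bar>f t - f s\<bar> \<le> V s"
        unfolding V_def using W_bdd st by (intro cSup_upper) auto
      then show ?thesis by simp
    qed
    then have "V t \<le> V s - \<bar>f t - f s\<bar>"
      unfolding V_def[of t] using W0 by (intro cSup_least) blast+
    then show ?thesis by simp
  qed
  \<comment> \<open>\<open>B\<close> consists of the points down to which the estimate has been
    carried from \<open>b\<close>. Its infimum \<open>m\<close> belongs to it, and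
    \<open>a < m\<close> would allow a further step to the left.\<close>
  define B where "B = {s \<in> {a..b}. f b - f s \<le> \<epsilon> * (b - s) + V s}"
  define m where "m = Inf B"
  have "b \<in> B" using V_nonneg \<open>a \<le> b\<close> by (simp add: B_def)
  have B_bdd: "bdd_below B" by (rule bdd_belowI[of _ a]) (auto simp: B_def)
  have m: "a \<le> m" "m \<le> b"
    unfolding m_def using \<open>b \<in> B\<close> B_bdd by (auto intro!: cInf_greatest cInf_lower simp: B_def)
  have "m \<in> closure B"
    unfolding m_def using \<open>b \<in> B\<close> B_bdd by (intro closure_contains_Inf) auto
  then obtain X where X: "\<And>n. X n \<in> B" "X \<longlonglongrightarrow> m"
    unfolding closure_sequential by blast
  \<comment> \<open>The points \<open>X n\<close> lie to the right of \<open>m\<close>, so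
    \<open>V (X n)\<close> can be replaced by the constant \<open>V m\<close> before passing to the
    limit.\<close>
  have "m \<in> B"
  proof -
    have Xm: "m \<le> X n" for n
      unfolding m_def using X(1) B_bdd by (intro cInf_lower)
    have "f b - f (X n) \<le> \<epsilon> * (b - X n) + V m" for n
      using X(1)[of n] V_mono[OF m(1) Xm[of n]] by (simp add: B_def)
    moreover have "(\<lambda>n. f (X n)) \<longlonglongrightarrow> f m"
    proof (rule continuous_on_tendsto_compose[OF abs_continuous_on_imp_continuous_on[OF ac] X(2)])
      show "m \<in> {a..b}" "\<forall>\<^sub>F n in sequentially. X n \<in> {a..b}"
        using m X(1) by (auto simp: B_def)
    qed
    ultimately have "f b - f m \<le> \<epsilon> * (b - m) + V m"
      by (intro LIMSEQ_le[OF tendsto_diff[OF tendsto_const]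
            tendsto_add[OF tendsto_mult[OF tendsto_const tendsto_diff[OF tendsto_const X(2)]] tendsto_const]])
        auto
    then show ?thesis using m by (simp add: B_def)
  qed
  have "m = a"
  proof (rule ccontr)
    assume "m \<noteq> a"
    then have "a < m" using m by simp
    then have ev: "\<forall>\<^sub>F s in at_left m. a < s \<and> s < m"
      by (auto simp: eventually_at_left)
    \<comment> \<open>Outside \<open>U\<close> the hypothesis on left increments supplies
      \<open>s\<close>; inside \<open>U\<close> the difference \<open>V s - V m\<close> pays for the
      increment of \<open>f\<close>.\<close>
    obtain s where s: "a < s" "s < m" "f m - f s \<le> \<epsilon> * (m - s) + (V s - V m)"
    proof (cases "m \<in> U")
      case False
      then have "\<forall>\<^sub>F s in at_left m. f m - f s \<le> \<epsilon> * (m - s)"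
        using good[of m] U(2) \<open>a < m\<close> m by auto
      then obtain s where "a < s" "s < m" "f m - f s \<le> \<epsilon> * (m - s)"
        using eventually_happens'[OF trivial_limit_at_left_real eventually_conj[OF ev]] by blast
      then show thesis using V_mono[of s m] by (intro that) auto
    next
      case True
      then obtain d where d: "d > 0" "ball m d \<subseteq> U" using U(1) openE by blast
      \<comment> \<open>The midpoint keeps \<open>s\<close> to the right of \<open>a\<close>, and
        \<open>m - d / 2\<close> keeps the interval inside the ball contained in
        \<open>U\<close>.\<close>
      define s where "s = max ((a + m) / 2) (m - d / 2)"
      have s: "a < s" "s < m" "m - d < s"
        using d \<open>a < m\<close> by (auto simp: s_def less_max_iff_disj)
      then have sU: "{s<..<m} \<subseteq> U"
        using d(2) by (intro order_trans[OF _ d(2)]) (auto simp: dist_real_def)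
      then have "f m - f s \<le> V s - V m" using V_step[of s m] m s by simp
      moreover have "0 \<le> \<epsilon> * (m - s)" using \<epsilon> s by simp
      ultimately show thesis using s by (intro that) auto
    qed
    moreover have "f b - f m \<le> \<epsilon> * (b - m) + V m" using \<open>m \<in> B\<close> by (simp add: B_def)
    ultimately have "f b - f s \<le> \<epsilon> * (b - s) + V s" by (simp add: right_diff_distrib)
    then have "s \<in> B" using s m by (simp add: B_def)
    then have "m \<le> s" unfolding m_def using B_bdd by (intro cInf_lower)
    then show False using s by simp
  qed
  then have "f b - f a \<le> \<epsilon> * (b - a) + \<epsilon>"
    using \<open>m \<in> B\<close> V_bound[of a] by (auto simp: B_def)
  also have "\<dots> = \<epsilon> * (b - a + 1)" by (simp only: distrib_left mult_1_right)
  also have "\<dots> = e"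
    using \<open>a \<le> b\<close> by (simp add: \<epsilon>_def)
  finally show "f b \<le> f a + e" by simp
qed

section \<open>Strongly convex functions on a Hilbert space\<close>

text \<open>\<open>Liminf (at x)\<close> only sees punctured neighbourhoods; the assumption
  \<open>c < f x\<close> adds the point itself.\<close>

lemma lsc_fun_eventually_greater:
  assumes "lsc_fun f" "c < f x"
  shows "\<forall>\<^sub>F y in nhds x. c < f y"
proof -
  have "\<forall>\<^sub>F y in at x. c < f y"
    using assms unfolding lsc_fun_def le_Liminf_iff by blast
  then have "\<forall>\<^sub>F y in nhds x. y \<noteq> x \<longrightarrow> c < f y"
    by (simp add: eventually_at_filter)
  then show ?thesis
    by eventually_elim (use assms in auto)
qed

lemma continuous_imp_lsc_fun:
  fixes f :: "'a::real_normed_vector \<Rightarrow> real"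
  assumes "continuous_on UNIV f"
  shows "lsc_fun (\<lambda>x. ereal (f x))"
  unfolding lsc_fun_def le_Liminf_iff
proof (intro allI impI)
  fix x c assume "c < ereal (f x)"
  moreover have "((\<lambda>x. ereal (f x)) \<longlongrightarrow> ereal (f x)) (at x)"
    using continuous_on_interior[OF assms, of x] by (simp add: continuous_within)
  ultimately show "\<forall>\<^sub>F x in at x. c < ereal (f x)"
    by (rule order_tendstoD(1)[rotated])
qed

lemma strongly_convex_fun_not_MInf:
  assumes "strongly_convex_fun \<sigma> R"
  shows "R x \<noteq> -\<infinity>"
proof
  assume "R x = -\<infinity>"
  moreover have "R x - ereal (\<sigma> / 2 * (norm x)\<^sup>2) \<noteq> -\<infinity>"
    using assms by (simp add: strongly_convex_fun_def Gamma0_def proper_fun_def)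
  ultimately show False by simp
qed

lemma norm_convex_combination:
  fixes x y :: "'a::real_inner"
  shows "(norm ((1 - t) *\<^sub>R x + t *\<^sub>R y))\<^sup>2
    = (1 - t) * (norm x)\<^sup>2 + t * (norm y)\<^sup>2 - t * (1 - t) * (norm (x - y))\<^sup>2"
  by (simp add: power2_norm_eq_inner inner_simps inner_commute[of y x] algebra_simps)

text \<open>The identity for the norm of a convex combination turns convexity of \<open>R\<close>
  minus the quadratic into convexity of \<open>R\<close> with a quadratic gain. Finiteness at the
  intermediate point is part of the conclusion, so that later estimates can use real
  numbers.\<close>

lemma strongly_convex_fun_ineq:
  fixes R :: "'a::real_inner \<Rightarrow> ereal"
  assumes sc: "strongly_convex_fun \<sigma> R"
    and x: "R x = ereal a" and y: "R y = ereal b" and t: "t \<in> {0..1}"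
  obtains c where "R ((1 - t) *\<^sub>R x + t *\<^sub>R y) = ereal c"
    "c \<le> (1 - t) * a + t * b - \<sigma> / 2 * (t * (1 - t) * (norm (x - y))\<^sup>2)"
proof -
  define z where "z = (1 - t) *\<^sub>R x + t *\<^sub>R y"
  have conv: "R z - ereal (\<sigma> / 2 * (norm z)\<^sup>2)
      \<le> ereal ((1 - t) * (a - \<sigma> / 2 * (norm x)\<^sup>2) + t * (b - \<sigma> / 2 * (norm y)\<^sup>2))"
  proof -
    have "convex_fun (\<lambda>x. R x - ereal (\<sigma> / 2 * (norm x)\<^sup>2))"
      using sc by (simp add: strongly_convex_fun_def Gamma0_def)
    then have "R z - ereal (\<sigma> / 2 * (norm z)\<^sup>2)
        \<le> ereal (1 - t) * (R x - ereal (\<sigma> / 2 * (norm x)\<^sup>2))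
          + ereal t * (R y - ereal (\<sigma> / 2 * (norm y)\<^sup>2))"
      using t unfolding convex_fun_def z_def by blast
    then show ?thesis by (simp add: x y)
  qed
  have "R z \<noteq> -\<infinity>" using sc by (rule strongly_convex_fun_not_MInf)
  with conv obtain c where c: "R z = ereal c" by (cases "R z") auto
  with conv have "c \<le> (1 - t) * (a - \<sigma> / 2 * (norm x)\<^sup>2) + t * (b - \<sigma> / 2 * (norm y)\<^sup>2)
      + \<sigma> / 2 * (norm z)\<^sup>2" by simp
  also have "\<dots> = (1 - t) * a + t * b - \<sigma> / 2 * (t * (1 - t) * (norm (x - y))\<^sup>2)"
  proof -
    have "(1 - t) * (a - k * X) + t * (b - k * Y) + k * ((1 - t) * X + t * Y - t * (1 - t) * D)
        = (1 - t) * a + t * b - k * (t * (1 - t) * D)" for k X Y D :: real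
      by (simp add: algebra_simps)
    then show ?thesis unfolding z_def norm_convex_combination .
  qed
  finally show thesis using that c by (simp add: z_def)
qed

text \<open>A maximising sequence for \<open>p \<bullet> y - R y\<close> is Cauchy by strong
  convexity, and lower semicontinuity makes its limit \<open>z\<close> a maximiser. Comparing
  \<open>z\<close> with points on segments starting at it gives the quadratic growth.\<close>

lemma strongly_convex_fun_conj_attained:
  fixes R :: "'a::{real_inner, complete_space} \<Rightarrow> ereal"
  assumes "\<sigma> > 0" and sc: "strongly_convex_fun \<sigma> R" and fin: "\<bar>fenchel_conj R p\<bar> \<noteq> \<infinity>"
  obtains z a where "R z = ereal a" "fenchel_conj R p = ereal (p \<bullet> z - a)"
    "\<forall>y. ereal (a + p \<bullet> (y - z) + \<sigma> / 2 * (norm (y - z))\<^sup>2) \<le> R y"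
proof -
  obtain s where s: "fenchel_conj R p = ereal s" using fin by auto
  have upper: "p \<bullet> y - b \<le> s" if "R y = ereal b" for y b
  proof -
    have "ereal (p \<bullet> y) - R y \<le> ereal s"
      unfolding s[symmetric] fenchel_conj_def by (rule SUP_upper) simp
    then show ?thesis by (simp add: that)
  qed
  have "\<exists>y b. R y = ereal b \<and> s - 1 / (real n + 1) < p \<bullet> y - b" for n
  proof -
    have "ereal (s - 1 / (real n + 1)) < (SUP y. ereal (p \<bullet> y) - R y)"
      unfolding s[unfolded fenchel_conj_def] by simp
    then obtain y where y: "ereal (s - 1 / (real n + 1)) < ereal (p \<bullet> y) - R y"
      unfolding less_SUP_iff by blast
    then show ?thesis
      using strongly_convex_fun_not_MInf[OF sc, of y] by (cases "R y") auto
  qed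
  then have "\<forall>n. \<exists>y b. R y = ereal b \<and> s - 1 / (real n + 1) < p \<bullet> y - b" by blast
  then obtain X where "\<forall>n. \<exists>b. R (X n) = ereal b \<and> s - 1 / (real n + 1) < p \<bullet> X n - b"
    unfolding choice_iff by blast
  then obtain b where X: "\<And>n. R (X n) = ereal (b n)"
    "\<And>n. s - 1 / (real n + 1) < p \<bullet> X n - b n" unfolding choice_iff by blast
  \<comment> \<open>Both points are almost optimal, while their midpoint gains
    \<open>\<sigma> / 8 * (norm (X m - X n))\<^sup>2\<close> and still cannot exceed the supremum
    \<open>s\<close>.\<close>
  have gap: "\<sigma> / 4 * (norm (X m - X n))\<^sup>2 \<le> 1 / (real m + 1) + 1 / (real n + 1)" for m n
  proof -
    obtain c where c: "R ((1 - 1/2) *\<^sub>R X m + (1/2) *\<^sub>R X n) = ereal c"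
      "c \<le> (1 - 1/2) * b m + (1/2) * b n - \<sigma> / 2 * ((1/2) * (1 - 1/2) * (norm (X m - X n))\<^sup>2)"
      using strongly_convex_fun_ineq[OF sc X(1)[of m] X(1)[of n], of "1/2"] by auto
    have "p \<bullet> ((1 - 1/2) *\<^sub>R X m + (1/2) *\<^sub>R X n) = (p \<bullet> X m + p \<bullet> X n) / 2"
      by (simp add: inner_simps)
    then show ?thesis using upper[OF c(1)] c(2) X(2)[of m] X(2)[of n] by simp
  qed
  have "Cauchy X"
  proof (rule metric_CauchyI)
    fix e :: real assume "e > 0"
    then have e: "\<sigma> / 8 * e\<^sup>2 > 0" using \<open>\<sigma> > 0\<close> by simp
    then obtain N where N: "inverse (real (Suc N)) < \<sigma> / 8 * e\<^sup>2"
      using reals_Archimedean by blast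
    have small: "1 / (real n + 1) < \<sigma> / 8 * e\<^sup>2" if "n \<ge> N" for n
    proof -
      have "1 / (real n + 1) \<le> 1 / (real N + 1)" using that by (simp add: frac_le)
      then show ?thesis using N by (simp add: inverse_eq_divide add.commute)
    qed
    have "dist (X m) (X n) < e" if "m \<ge> N" "n \<ge> N" for m n
    proof -
      have "\<sigma> / 4 * (norm (X m - X n))\<^sup>2 < \<sigma> / 4 * e\<^sup>2"
        using gap[of m n] small[of m] small[of n] that by simp
      then have "(norm (X m - X n))\<^sup>2 < e\<^sup>2" using \<open>\<sigma> > 0\<close> by simp
      then show ?thesis using \<open>e > 0\<close> by (simp add: dist_norm power_less_imp_less_base)
    qed
    then show "\<exists>M. \<forall>m\<ge>M. \<forall>n\<ge>M. dist (X m) (X n) < e" by blast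
  qed
  then obtain z where z: "X \<longlonglongrightarrow> z" using Cauchy_convergent_iff convergent_def by blast
  \<comment> \<open>Lower semicontinuity is given for \<open>R\<close> minus the quadratic, so the
    limit is taken in \<open>h\<close> and the continuous quadratic joins the upper bound.\<close>
  define h where "h = (\<lambda>x. R x - ereal (\<sigma> / 2 * (norm x)\<^sup>2))"
  have lsc: "lsc_fun h"
    using sc unfolding h_def strongly_convex_fun_def Gamma0_def by simp
  have hz: "h z \<le> ereal (p \<bullet> z - s - \<sigma> / 2 * (norm z)\<^sup>2)"
  proof (rule ccontr)
    assume "\<not> ?thesis"
    then have "ereal (p \<bullet> z - s - \<sigma> / 2 * (norm z)\<^sup>2) < h z" by (simp only: not_le)
    then obtain c where c: "p \<bullet> z - s - \<sigma> / 2 * (norm z)\<^sup>2 < c" "ereal c < h z"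
      using ereal_dense2 less_ereal.simps(1) by blast
    have "\<forall>\<^sub>F n in sequentially. ereal c < h (X n)"
      using lsc_fun_eventually_greater[OF lsc c(2)] z by (rule eventually_compose_filterlim)
    then have "\<forall>\<^sub>F n in sequentially. c \<le> p \<bullet> X n - s + 1 / (real n + 1) - \<sigma> / 2 * (norm (X n))\<^sup>2"
    proof eventually_elim
      case (elim n)
      then show ?case using X[of n] by (simp add: h_def)
    qed
    moreover have "(\<lambda>n. p \<bullet> X n - s + 1 / (real n + 1) - \<sigma> / 2 * (norm (X n))\<^sup>2)
        \<longlonglongrightarrow> p \<bullet> z - s + 0 - \<sigma> / 2 * (norm z)\<^sup>2"
      using LIMSEQ_inverse_real_of_nat
      by (intro tendsto_intros z) (simp add: inverse_eq_divide add.commute)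
    ultimately have "c \<le> p \<bullet> z - s + 0 - \<sigma> / 2 * (norm z)\<^sup>2"
      by (intro tendsto_lowerbound[of _ _ sequentially]) auto
    then show False using c(1) by simp
  qed
  obtain a where a: "R z = ereal a" "a \<le> p \<bullet> z - s"
    using hz strongly_convex_fun_not_MInf[OF sc, of z] by (cases "R z") (auto simp: h_def)
  then have s_eq: "s = p \<bullet> z - a" using upper[OF a(1)] by simp
  have "ereal (a + p \<bullet> (y - z) + \<sigma> / 2 * (norm (y - z))\<^sup>2) \<le> R y" for y
  proof (cases "R y")
    case (real b)
    \<comment> \<open>Optimality of \<open>z\<close> against a point of the segment, divided by
      \<open>t\<close>; the factor \<open>1 - t\<close> disappears as \<open>t\<close> tends to
      \<open>0\<close>.\<close>
    have "a + p \<bullet> (y - z) + (1 - t) * (\<sigma> / 2 * (norm (y - z))\<^sup>2) \<le> b" if t: "0 < t" "t < 1" for t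
    proof -
      obtain c where c: "R ((1 - t) *\<^sub>R z + t *\<^sub>R y) = ereal c"
        "c \<le> (1 - t) * a + t * b - \<sigma> / 2 * (t * (1 - t) * (norm (z - y))\<^sup>2)"
        using strongly_convex_fun_ineq[OF sc a(1) real, of t] t by auto
      define d W where "d = p \<bullet> (y - z)" and "W = \<sigma> / 2 * (norm (y - z))\<^sup>2"
      have "p \<bullet> ((1 - t) *\<^sub>R z + t *\<^sub>R y) = p \<bullet> z + t * d"
        by (simp add: d_def inner_simps algebra_simps)
      then have "a + t * d \<le> c" using upper[OF c(1)] by (simp add: s_eq)
      also have "c \<le> (1 - t) * a + t * b - t * (1 - t) * W"
        using c(2) by (simp add: W_def norm_minus_commute mult_ac)
      finally have "t * (a + d + (1 - t) * W) \<le> t * b" by (simp add: algebra_simps)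
      then show ?thesis using t by (simp add: d_def W_def)
    qed
    then have "\<forall>\<^sub>F t in at_right 0. a + p \<bullet> (y - z) + (1 - t) * (\<sigma> / 2 * (norm (y - z))\<^sup>2) \<le> b"
      unfolding eventually_at_right_field by (intro exI[of _ 1]) auto
    moreover have "((\<lambda>t. a + p \<bullet> (y - z) + (1 - t) * (\<sigma> / 2 * (norm (y - z))\<^sup>2)) \<longlongrightarrow>
        a + p \<bullet> (y - z) + (1 - 0) * (\<sigma> / 2 * (norm (y - z))\<^sup>2)) (at_right 0)"
      by (intro tendsto_intros)
    ultimately have "a + p \<bullet> (y - z) + (1 - 0) * (\<sigma> / 2 * (norm (y - z))\<^sup>2) \<le> b"
      by (intro tendsto_upperbound[of _ _ "at_right 0"]) auto
    then show ?thesis using real by simp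
  qed (use strongly_convex_fun_not_MInf[OF sc, of y] in auto)
  then show thesis using a(1) s unfolding s_eq by (intro that[of z a]) blast+
qed

text \<open>The representer of \<open>f\<close> is the minimiser of \<open>\<parallel>x\<parallel>\<^sup>2 / 2 - f x\<close>.\<close>

lemma riesz_representation:
  fixes f :: "'a::{real_inner, complete_space} \<Rightarrow> real"
  assumes "bounded_linear f"
  obtains z where "\<And>x. f x = x \<bullet> z"
proof -
  interpret f: bounded_linear f by fact
  define R where "R = (\<lambda>x. ereal ((norm x)\<^sup>2 / 2 - f x))"
  have sc: "strongly_convex_fun 1 R"
  proof -
    have "(\<lambda>x. R x - ereal (1 / 2 * (norm x)\<^sup>2)) = (\<lambda>x. ereal (- f x))"
      by (simp add: R_def fun_eq_iff)
    moreover have "lsc_fun (\<lambda>x. ereal (- f x))"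
      by (intro continuous_imp_lsc_fun continuous_intros f.continuous_on)
    ultimately show ?thesis
      by (simp add: strongly_convex_fun_def Gamma0_def proper_fun_def convex_fun_def
          f.add f.scaleR)
  qed
  \<comment> \<open>Completing the square bounds \<open>f x - (norm x)\<^sup>2 / 2\<close> from
    above, so the conjugate at \<open>0\<close> is finite and the minimiser exists.\<close>
  have "fenchel_conj R 0 \<le> ereal ((onorm f)\<^sup>2 / 2)"
    unfolding fenchel_conj_def
  proof (rule SUP_least)
    fix x
    have "f x - (norm x)\<^sup>2 / 2 \<le> onorm f * norm x - (norm x)\<^sup>2 / 2"
      using onorm[OF assms, of x] by simp
    also have "\<dots> \<le> (onorm f)\<^sup>2 / 2"
      using zero_le_power2[of "onorm f - norm x"] by (simp add: power2_eq_square algebra_simps)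
    finally show "ereal (0 \<bullet> x) - R x \<le> ereal ((onorm f)\<^sup>2 / 2)"
      by (simp add: R_def)
  qed
  moreover have "ereal (0 \<bullet> 0) - R 0 \<le> fenchel_conj R 0"
    unfolding fenchel_conj_def by (rule SUP_upper2[of 0]) auto
  ultimately have fin: "\<bar>fenchel_conj R 0\<bar> \<noteq> \<infinity>"
    by (auto simp: R_def f.zero)
  obtain z a where z: "R z = ereal a"
    "\<forall>y. ereal (a + 0 \<bullet> (y - z) + 1 / 2 * (norm (y - z))\<^sup>2) \<le> R y"
    using strongly_convex_fun_conj_attained[OF zero_less_one sc fin] by blast
  \<comment> \<open>In the growth inequality at \<open>z + w\<close> the terms
    \<open>(norm w)\<^sup>2 / 2\<close> cancel and only linear ones remain; using \<open>w\<close>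
    and \<open>- w\<close> turns the bound into an equality.\<close>
  have le: "f w \<le> w \<bullet> z" for w
  proof -
    have "a + (norm w)\<^sup>2 / 2 \<le> (norm (z + w))\<^sup>2 / 2 - (f z + f w)" "a = (norm z)\<^sup>2 / 2 - f z"
      using z(2)[rule_format, of "z + w"] z(1) by (simp_all add: R_def f.add)
    moreover have "(norm (z + w))\<^sup>2 = (norm z)\<^sup>2 + 2 * (w \<bullet> z) + (norm w)\<^sup>2"
      by (simp add: power2_norm_eq_inner inner_simps inner_commute[of z w])
    ultimately show ?thesis by (simp add: add_divide_distrib)
  qed
  have "f x = x \<bullet> z" for x
    using le[of x] le[of "- x"] by (simp add: f.neg)
  then show thesis by (rule that)
qed

text \<open>\<open>adjoint\<close> is a choice among the functions with this property, so it
  suffices that one exists; the Riesz representers of \<open>\<lambda>x. A x \<bullet> y\<close>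
  provide it.\<close>

lemma inner_adjoint_Hilbert:
  fixes A :: "'a::{real_inner, complete_space} \<Rightarrow> 'b::real_inner"
  assumes "bounded_linear A"
  shows "x \<bullet> adjoint A y = A x \<bullet> y"
proof -
  have "\<exists>w. \<forall>x. A x \<bullet> y = x \<bullet> w" for y
    by (rule riesz_representation[OF bounded_linear_compose[OF bounded_linear_inner_left assms]]) blast
  then have "\<exists>f. \<forall>x y. A x \<bullet> y = x \<bullet> f y" by metis
  then have "\<forall>x y. A x \<bullet> y = x \<bullet> adjoint A y"
    unfolding adjoint_def by (rule someI_ex)
  then show ?thesis by simp
qed

lemma linear_adjoint_Hilbert:
  fixes A :: "'a::{real_inner, complete_space} \<Rightarrow> 'b::real_inner"
  assumes "bounded_linear A"
  shows "linear (adjoint A)"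
proof (rule linearI)
  show "adjoint A (y + z) = adjoint A y + adjoint A z" for y z
    by (rule vector_eq_ldot[THEN iffD1]) (simp add: inner_adjoint_Hilbert[OF assms] inner_simps)
  show "adjoint A (c *\<^sub>R y) = c *\<^sub>R adjoint A y" for c y
    by (rule vector_eq_ldot[THEN iffD1]) (simp add: inner_adjoint_Hilbert[OF assms] inner_simps)
qed

text \<open>If \<open>z\<close> is the maximiser defining the conjugate at \<open>p\<close>, the
  affine function \<open>v \<bullet> z - R z\<close> touches the conjugate from below at
  \<open>p\<close>, so both have the same derivative there and \<open>g = z\<close>.\<close>

lemma has_gradient_fenchel_conj:
  fixes R :: "'a::{real_inner, complete_space} \<Rightarrow> ereal"
  assumes "\<sigma> > 0" and sc: "strongly_convex_fun \<sigma> R" and grad: "has_gradient (fenchel_conj R) p g"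
  obtains a where "R g = ereal a" "fenchel_conj R p = ereal (p \<bullet> g - a)"
    "\<forall>y. ereal (a + p \<bullet> (y - g) + \<sigma> / 2 * (norm (y - g))\<^sup>2) \<le> R y"
proof -
  have fin: "\<forall>\<^sub>F v in nhds p. \<bar>fenchel_conj R v\<bar> \<noteq> \<infinity>"
    and der: "((\<lambda>v. real_of_ereal (fenchel_conj R v)) has_derivative (\<lambda>h. h \<bullet> g)) (at p)"
    using grad by (auto simp: has_gradient_def gderiv_def)
  obtain z a where z: "R z = ereal a" "fenchel_conj R p = ereal (p \<bullet> z - a)"
    "\<forall>y. ereal (a + p \<bullet> (y - z) + \<sigma> / 2 * (norm (y - z))\<^sup>2) \<le> R y"
    using strongly_convex_fun_conj_attained[OF \<open>\<sigma> > 0\<close> sc eventually_nhds_x_imp_x[OF fin]] by blast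
  have "((\<lambda>v. real_of_ereal (fenchel_conj R v) - v \<bullet> z) has_derivative (\<lambda>h. h \<bullet> g - h \<bullet> z)) (at p)"
    by (intro has_derivative_diff der bounded_linear_imp_has_derivative bounded_linear_inner_left)
  moreover have "\<forall>\<^sub>F v in at p. real_of_ereal (fenchel_conj R p) - p \<bullet> z
      \<le> real_of_ereal (fenchel_conj R v) - v \<bullet> z"
  proof -
    have "\<forall>\<^sub>F v in at p. \<bar>fenchel_conj R v\<bar> \<noteq> \<infinity>"
      using fin by (auto simp: eventually_at_filter elim: eventually_mono)
    then show ?thesis
    proof eventually_elim
      case (elim v)
      then obtain c where c: "fenchel_conj R v = ereal c" by auto
      have "ereal (v \<bullet> z) - R z \<le> ereal c"
        unfolding c[symmetric] fenchel_conj_def by (rule SUP_upper) simp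
      then show ?case using z by (simp add: c)
    qed
  qed
  ultimately have "(\<lambda>h. h \<bullet> g - h \<bullet> z) = (\<lambda>_. 0)"
    by (rule has_derivative_local_min)
  then have "\<forall>h. h \<bullet> g = h \<bullet> z" by (simp add: fun_eq_iff)
  then have "g = z" by (simp only: vector_eq_ldot)
  show thesis by (rule that; unfold \<open>g = z\<close>; fact z)
qed

text \<open>The maximiser \<open>z\<close> for \<open>- adjoint A udag\<close> gives
  \<open>dual_lim\<close> a quadratic upper bound around \<open>udag\<close> with slope
  \<open>ybar - A z\<close>; minimality forces this slope to vanish.\<close>

lemma dual_lim_minimizer:
  fixes A :: "'x::{real_inner, complete_space} \<Rightarrow> 'y::real_inner"
  assumes A: "bounded_linear A" and "\<sigma> > 0" and sc: "strongly_convex_fun \<sigma> R"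
    and min: "\<And>v. dual_lim A R ybar udag \<le> dual_lim A R ybar v"
    and fin: "\<bar>dual_lim A R ybar udag\<bar> \<noteq> \<infinity>"
  obtains z a where "A z = ybar" "R z = ereal a" "dual_lim A R ybar udag = ereal (- a)"
    "\<forall>y. ereal (a - adjoint A udag \<bullet> (y - z) + \<sigma> / 2 * (norm (y - z))\<^sup>2) \<le> R y"
proof -
  define p where "p = - adjoint A udag"
  interpret adj: linear "adjoint A" using A by (rule linear_adjoint_Hilbert)
  have pfin: "\<bar>fenchel_conj R p\<bar> \<noteq> \<infinity>"
    using fin by (auto simp: dual_lim_def p_def)
  obtain z a where z: "R z = ereal a" "fenchel_conj R p = ereal (p \<bullet> z - a)"
    "\<forall>y. ereal (a + p \<bullet> (y - z) + \<sigma> / 2 * (norm (y - z))\<^sup>2) \<le> R y"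
    using strongly_convex_fun_conj_attained[OF \<open>\<sigma> > 0\<close> sc pfin] by blast
  \<comment> \<open>Quadratic growth of \<open>R\<close> with modulus \<open>\<sigma>\<close>
    dualises, by completing the square, to a quadratic upper bound with modulus
    \<open>1 / \<sigma>\<close>.\<close>
  have smooth: "fenchel_conj R (p + h) \<le> ereal (p \<bullet> z - a + h \<bullet> z + (norm h)\<^sup>2 / (2 * \<sigma>))" for h
    unfolding fenchel_conj_def
  proof (rule SUP_least)
    fix y
    show "ereal ((p + h) \<bullet> y) - R y \<le> ereal (p \<bullet> z - a + h \<bullet> z + (norm h)\<^sup>2 / (2 * \<sigma>))"
    proof (cases "R y")
      case (real b)
      have "0 \<le> (norm (\<sigma> *\<^sub>R (y - z) - h))\<^sup>2 / (2 * \<sigma>)" using \<open>\<sigma> > 0\<close> by simp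
      also have "\<dots> = (\<sigma>\<^sup>2 * (norm (y - z))\<^sup>2 - 2 * \<sigma> * (h \<bullet> (y - z)) + (norm h)\<^sup>2) / (2 * \<sigma>)"
        unfolding power2_norm_eq_inner
        by (simp add: inner_diff_left[of "\<sigma> *\<^sub>R (y - z)"] inner_diff_right[of _ "\<sigma> *\<^sub>R (y - z)"]
            inner_commute[of y h] inner_commute[of z h] power2_eq_square algebra_simps)
      also have "\<dots> = \<sigma> / 2 * (norm (y - z))\<^sup>2 - h \<bullet> (y - z) + (norm h)\<^sup>2 / (2 * \<sigma>)"
        using \<open>\<sigma> > 0\<close> by (simp add: field_simps power2_eq_square)
      finally show ?thesis using z(3)[rule_format, of y] by (simp add: real inner_simps)
    qed (use strongly_convex_fun_not_MInf[OF sc, of y] in auto)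
  qed
  define k where "k = ybar - A z"
  \<comment> \<open>Moving \<open>udag\<close> by \<open>s\<close> against \<open>k\<close> changes
    the upper bound by \<open>- s * (norm k)\<^sup>2\<close> plus a term quadratic in
    \<open>s\<close>; dividing by \<open>s > 0\<close> and letting it tend to \<open>0\<close> gives
    \<open>k = 0\<close>.\<close>
  have "s * (norm k)\<^sup>2 \<le> s * (s * ((norm (adjoint A k))\<^sup>2 / (2 * \<sigma>)))" for s
  proof -
    have "- adjoint A (udag - s *\<^sub>R k) = p + s *\<^sub>R adjoint A k"
      by (simp add: p_def adj.diff adj.scale)
    then have "dual_lim A R ybar (udag - s *\<^sub>R k)
        \<le> ereal (p \<bullet> z - a + (s *\<^sub>R adjoint A k) \<bullet> z + (norm (s *\<^sub>R adjoint A k))\<^sup>2 / (2 * \<sigma>))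
          + ereal (ybar \<bullet> (udag - s *\<^sub>R k))"
      unfolding dual_lim_def by (simp only: add_right_mono smooth)
    moreover have "dual_lim A R ybar udag = ereal (p \<bullet> z - a + ybar \<bullet> udag)"
      using z(2) by (simp add: dual_lim_def p_def)
    moreover have "dual_lim A R ybar udag \<le> dual_lim A R ybar (udag - s *\<^sub>R k)" by (rule min)
    ultimately have "ereal (p \<bullet> z - a + ybar \<bullet> udag)
        \<le> ereal (p \<bullet> z - a + (s *\<^sub>R adjoint A k) \<bullet> z + (norm (s *\<^sub>R adjoint A k))\<^sup>2 / (2 * \<sigma>))
          + ereal (ybar \<bullet> (udag - s *\<^sub>R k))" by (metis order_trans)
    then have "p \<bullet> z - a + ybar \<bullet> udag \<le> p \<bullet> z - a + s * (adjoint A k \<bullet> z)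
        + s\<^sup>2 * (norm (adjoint A k))\<^sup>2 / (2 * \<sigma>) + ybar \<bullet> (udag - s *\<^sub>R k)"
      by (simp add: power_mult_distrib)
    moreover have "adjoint A k \<bullet> z = A z \<bullet> k"
      using inner_adjoint_Hilbert[OF A] by (simp add: inner_commute)
    moreover have "(norm k)\<^sup>2 = ybar \<bullet> k - A z \<bullet> k"
      by (simp add: power2_norm_eq_inner k_def inner_diff_left)
    ultimately show ?thesis
      by (simp add: inner_diff_right power2_eq_square right_diff_distrib)
  qed
  then have "(norm k)\<^sup>2 \<le> s * ((norm (adjoint A k))\<^sup>2 / (2 * \<sigma>))" if "0 < s" for s
    using that by (rule mult_left_le_imp_le)
  then have "\<forall>\<^sub>F s in at_right 0. (norm k)\<^sup>2 \<le> s * ((norm (adjoint A k))\<^sup>2 / (2 * \<sigma>))"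
    unfolding eventually_at_right_field by (intro exI[of _ 1]) simp
  moreover have "((\<lambda>s. s * ((norm (adjoint A k))\<^sup>2 / (2 * \<sigma>))) \<longlongrightarrow>
      0 * ((norm (adjoint A k))\<^sup>2 / (2 * \<sigma>))) (at_right 0)"
    by (intro tendsto_intros)
  ultimately have "(norm k)\<^sup>2 \<le> 0 * ((norm (adjoint A k))\<^sup>2 / (2 * \<sigma>))"
    by (intro tendsto_lowerbound[of _ _ "at_right 0"]) auto
  then have Az: "A z = ybar" by (simp add: k_def)
  have "p \<bullet> z + ybar \<bullet> udag = 0"
    using inner_adjoint_Hilbert[OF A, of z udag] by (simp add: p_def Az inner_commute)
  then have "dual_lim A R ybar udag = ereal (- a)"
    using z(2) by (simp add: dual_lim_def p_def)
  moreover have "\<forall>y. ereal (a - adjoint A udag \<bullet> (y - z) + \<sigma> / 2 * (norm (y - z))\<^sup>2) \<le> R y"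
    using z(3) by (simp add: p_def)
  ultimately show thesis using that Az z(1) by blast
qed

section \<open>Consequences of the local growth of the data-fit function\<close>

text \<open>\<open>w\<close> is the point at distance \<open>s\<close> from \<open>ybar\<close> on
  the segment to \<open>y\<close>. Growth holds there, and convexity with \<open>f ybar = 0\<close>
  transfers it to \<open>y\<close> with the factor \<open>norm (y - ybar) / s\<close>.\<close>

lemma convex_fun_growth_extends:
  fixes f :: "'a::real_normed_vector \<Rightarrow> ereal"
  assumes conv: "convex_fun f" and f0: "f ybar = 0"
    and growth: "\<And>y. ereal (dist y ybar) < \<rho> \<Longrightarrow> ereal (\<kappa> * norm (y - ybar) powr q) \<le> f y"
    and s: "0 < s" "ereal s < \<rho>" "s \<le> norm (y - ybar)"
  shows "ereal (\<kappa> * s powr (q - 1) * norm (y - ybar)) \<le> f y"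
proof -
  define r where "r = norm (y - ybar)"
  define w where "w = (1 - s / r) *\<^sub>R ybar + (s / r) *\<^sub>R y"
  have r: "r > 0" "s \<le> r" using s by (auto simp: r_def)
  have "w - ybar = (s / r) *\<^sub>R (y - ybar)" by (simp add: w_def algebra_simps)
  then have wn: "norm (w - ybar) = s" using r s by (simp add: r_def[symmetric])
  have "ereal (\<kappa> * s powr q) \<le> f w"
    using growth[of w] wn s by (simp add: dist_norm)
  also have "f w \<le> ereal (1 - s / r) * f ybar + ereal (s / r) * f y"
    using conv r s unfolding convex_fun_def w_def by simp
  finally have le: "ereal (\<kappa> * s powr q) \<le> ereal (s / r) * f y" by (simp add: f0)
  show ?thesis
  proof (cases "f y")
    case (real b)
    have "\<kappa> * s powr (q - 1) * r = (r / s) * (\<kappa> * s powr q)"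
      using s by (simp add: powr_diff)
    also have "\<dots> \<le> (r / s) * (s / r * b)"
      using le real r s by (intro mult_left_mono) auto
    also have "\<dots> = b" using r s by simp
    finally show ?thesis using real by (simp add: r_def)
  next
    case MInf
    then show ?thesis using le r s by simp
  qed simp
qed

text \<open>A radius less than \<open>\<rho>\<close> and at most the distance from \<open>y\<close>
  to \<open>ybar\<close> carries the local growth to \<open>y\<close>. This makes the data fit
  nonnegative on the whole space.\<close>

lemma convex_fun_growth_pos:
  fixes f :: "'a::real_normed_vector \<Rightarrow> ereal"
  assumes "convex_fun f" "f ybar = 0" "0 < \<kappa>" "0 < \<rho>" "y \<noteq> ybar"
    and "\<And>y. ereal (dist y ybar) < \<rho> \<Longrightarrow> ereal (\<kappa> * norm (y - ybar) powr q) \<le> f y"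
  shows "0 < f y"
proof -
  obtain s0 where s0: "0 < ereal s0" "ereal s0 < \<rho>" using ereal_dense2 \<open>0 < \<rho>\<close> by blast
  define s where "s = min s0 (norm (y - ybar))"
  have s: "0 < s" "ereal s < \<rho>" "s \<le> norm (y - ybar)"
    using s0 \<open>y \<noteq> ybar\<close> order.strict_trans1[of "ereal s" "ereal s0" \<rho>] by (auto simp: s_def)
  have "0 < ereal (\<kappa> * s powr (q - 1) * norm (y - ybar))"
    using s assms by simp
  then show ?thesis
    using convex_fun_growth_extends[OF assms(1,2,6) s] by (rule less_le_trans)
qed

text \<open>\<open>growth_error \<gamma> q a\<close> bounds the supremum of \<open>a * r - \<gamma> / q * r powr q\<close> over \<open>r \<ge> 0\<close> when
  \<open>1 < q\<close>; it is not sharp, but has the optimal exponent \<open>q / (q - 1)\<close> of \<open>a\<close>.\<close>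

definition growth_error :: "real \<Rightarrow> real \<Rightarrow> real \<Rightarrow> real" where
  "growth_error \<gamma> q a = (if q = 1 then 0 else a * (q * a / \<gamma>) powr (1 / (q - 1)))"

text \<open>Outside the ball convexity gives linear growth, with a slope that bounds
  \<open>a\<close> through \<open>radius_pow\<close>. Inside it, for \<open>1 < q\<close>, either
  the growth dominates \<open>a * r\<close> or \<open>r\<close> is so small that
  \<open>a * r\<close> stays below the error.\<close>

lemma linear_le_convex_growth:
  fixes f :: "'a::real_normed_vector \<Rightarrow> ereal"
  assumes conv: "convex_fun f" and f0: "f ybar = 0" and "1 \<le> q" "0 < \<rho>" "0 < \<gamma>"
    and growth: "\<And>y. ereal (dist y ybar) < \<rho> \<Longrightarrow> ereal (\<gamma> / q * norm (y - ybar) powr q) \<le> f y"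
    and a: "0 \<le> a" "ereal a \<le> ereal (\<gamma> / q) * radius_pow \<rho> q"
  shows "ereal (a * norm (y - ybar)) \<le> f y + ereal (growth_error \<gamma> q a)"
proof (cases "y = ybar")
  case True
  then show ?thesis using a \<open>1 \<le> q\<close> by (simp add: f0 growth_error_def)
next
  case False
  define r where "r = norm (y - ybar)"
  have r: "r > 0" using False by (simp add: r_def)
  have err: "0 \<le> growth_error \<gamma> q a" using a by (simp add: growth_error_def)
  have ext: "ereal (\<gamma> / q * s powr (q - 1) * r) \<le> f y"
    if "0 < s" "ereal s < \<rho>" "s \<le> r" for s
    unfolding r_def
    by (rule convex_fun_growth_extends[OF conv f0 growth]) (use that in \<open>auto simp: r_def\<close>)
  have pos: "0 < f y"
    using convex_fun_growth_pos[OF conv f0 _ \<open>0 < \<rho>\<close> False growth] \<open>0 < \<gamma>\<close> \<open>1 \<le> q\<close> by simp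
  have enough: ?thesis if "ereal (a * r) \<le> f y"
  proof -
    have "ereal (a * r) + 0 \<le> f y + ereal (growth_error \<gamma> q a)"
      using that err by (intro add_mono) auto
    then show ?thesis by (simp add: r_def)
  qed
  show ?thesis
  proof (cases "q = 1")
    case True
    \<comment> \<open>For \<open>q = 1\<close> the factor \<open>s powr (q - 1)\<close> is
      \<open>1\<close>, so every admissible radius gives the same slope
      \<open>\<gamma>\<close>.\<close>
    obtain s0 where s0: "0 < ereal s0" "ereal s0 < \<rho>" using ereal_dense2 \<open>0 < \<rho>\<close> by blast
    define s where "s = min s0 r"
    have s: "0 < s" "ereal s < \<rho>" "s \<le> r"
      using s0 r order.strict_trans1[of "ereal s" "ereal s0" \<rho>] by (auto simp: s_def)
    have "a * r \<le> \<gamma> * r"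
      using a(2) r True by (simp add: radius_pow_def)
    also have "ereal (\<gamma> * r) \<le> f y" using ext[OF s] s True by simp
    finally show ?thesis by (intro enough) simp
  next
    case False
    then have q: "q > 1" using \<open>1 \<le> q\<close> by simp
    show ?thesis
    proof (cases "ereal r < \<rho>")
      case True
      show ?thesis
      proof (cases "a \<le> \<gamma> / q * r powr (q - 1)")
        case True
        have "a * r \<le> \<gamma> / q * r powr (q - 1) * r"
          using True r by (intro mult_right_mono) auto
        also have "ereal (\<gamma> / q * r powr (q - 1) * r) \<le> f y"
          using ext[of r] r \<open>ereal r < \<rho>\<close> by simp
        finally show ?thesis by (intro enough) simp
      next
        case False
        then have "r powr (q - 1) < q * a / \<gamma>"
          using q \<open>0 < \<gamma>\<close> by (simp add: field_simps)
        then have "(r powr (q - 1)) powr (1 / (q - 1)) \<le> (q * a / \<gamma>) powr (1 / (q - 1))"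
          using q by (intro powr_mono2) auto
        then have "r \<le> (q * a / \<gamma>) powr (1 / (q - 1))"
          using r q by (simp add: powr_powr)
        then have "a * r \<le> growth_error \<gamma> q a"
          using a q by (auto simp: growth_error_def intro: mult_left_mono)
        then have "0 + ereal (a * r) \<le> f y + ereal (growth_error \<gamma> q a)"
          using pos by (intro add_mono) auto
        then show ?thesis by (simp add: r_def)
      qed
    next
      case False
      then obtain \<rho>' where \<rho>: "\<rho> = ereal \<rho>'" using \<open>0 < \<rho>\<close> by (cases \<rho>) auto
      have \<rho>': "0 < \<rho>'" "\<rho>' \<le> r" using False \<open>0 < \<rho>\<close> \<rho> by auto
      \<comment> \<open>The ball is open, so radii strictly below \<open>\<rho>'\<close> are used
        and the slope at \<open>\<rho>'\<close> is reached as a limit from the left.\<close>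
      have "ereal (\<gamma> / q * \<rho>' powr (q - 1) * r) \<le> f y"
      proof (rule tendsto_upperbound[of "\<lambda>s. ereal (\<gamma> / q * s powr (q - 1) * r)" _ "at_left \<rho>'"])
        show "((\<lambda>s. ereal (\<gamma> / q * s powr (q - 1) * r)) \<longlongrightarrow> ereal (\<gamma> / q * \<rho>' powr (q - 1) * r)) (at_left \<rho>')"
          using \<rho>' by (intro tendsto_intros) auto
        show "\<forall>\<^sub>F s in at_left \<rho>'. ereal (\<gamma> / q * s powr (q - 1) * r) \<le> f y"
          unfolding eventually_at_left_field using \<rho>' \<rho> ext
          by (intro exI[of _ 0]) auto
      qed simp
      moreover have "a * r \<le> \<gamma> / q * \<rho>' powr (q - 1) * r"
        using a(2) r q \<rho> by (intro mult_right_mono) (auto simp: radius_pow_def)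
      ultimately show ?thesis
        by (intro enough) (meson ereal_less_eq(3) order_trans)
    qed
  qed
qed

section \<open>The dual functions\<close>

text \<open>On the right the parameter is only a factor of \<open>f\<close>, so dual functions can
  be compared term by term in the supremum.\<close>

lemma scaled_fenchel_conj:
  assumes "0 < \<mu>"
  shows "ereal (1 / \<mu>) * fenchel_conj f (\<mu> *\<^sub>R u) = (SUP y. ereal (u \<bullet> y) - ereal (1 / \<mu>) * f y)"
proof -
  have "ereal (1 / \<mu>) * fenchel_conj f (\<mu> *\<^sub>R u)
      = (SUP y. ereal (1 / \<mu>) * (ereal ((\<mu> *\<^sub>R u) \<bullet> y) - f y))"
    unfolding fenchel_conj_def using assms by (intro Sup_ereal_mult_left') auto
  also have "\<dots> = (SUP y. ereal (u \<bullet> y) - ereal (1 / \<mu>) * f y)"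
  proof (rule SUP_cong)
    show "ereal (1 / \<mu>) * (ereal ((\<mu> *\<^sub>R u) \<bullet> y) - f y) = ereal (u \<bullet> y) - ereal (1 / \<mu>) * f y" for y
      using assms by (cases "f y") (auto simp: right_diff_distrib)
  qed simp
  finally show ?thesis .
qed

text \<open>The supremum is tested at \<open>ybar\<close>, where the data fit vanishes.\<close>

lemma dual_lim_le_dual_diag:
  assumes "0 < \<mu>" "l ybar ybar = 0"
  shows "dual_lim A R ybar v \<le> dual_diag A R l ybar \<mu> v"
proof -
  have "ereal (v \<bullet> ybar) - ereal (1 / \<mu>) * l ybar ybar
      \<le> ereal (1 / \<mu>) * fenchel_conj (\<lambda>z. l z ybar) (\<mu> *\<^sub>R v)"
    unfolding scaled_fenchel_conj[OF assms(1)] by (rule SUP_upper) simp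
  then show ?thesis
    unfolding dual_lim_def dual_diag_def
    by (intro add_left_mono) (simp add: assms(2) inner_commute)
qed

lemma dual_diag_mono:
  assumes "0 < \<mu>" "\<mu> \<le> \<nu>" and nonneg: "\<And>z. 0 \<le> l z ybar"
  shows "dual_diag A R l ybar \<mu> v \<le> dual_diag A R l ybar \<nu> v"
  unfolding dual_diag_def scaled_fenchel_conj[OF assms(1)] scaled_fenchel_conj[OF less_le_trans[OF assms(1,2)]]
proof (intro add_left_mono SUP_mono')
  fix y
  have "1 / \<nu> \<le> 1 / \<mu>" using assms(1,2) by (simp add: frac_le)
  then show "ereal (v \<bullet> y) - ereal (1 / \<mu>) * l y ybar \<le> ereal (v \<bullet> y) - ereal (1 / \<nu>) * l y ybar"
    using nonneg[of y] by (intro ereal_minus_mono ereal_mult_right_mono) auto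
qed

text \<open>Cauchy-Schwarz and the linear bound control each term of the supremum; the error enters
  \<open>bound\<close> as \<open>\<mu> * e\<close> because the data fit is divided by
  \<open>\<mu>\<close>.\<close>

lemma dual_diag_le_dual_lim:
  assumes "0 < \<mu>" and nonneg: "\<And>z. 0 \<le> l z ybar"
    and bound: "\<And>z. ereal (\<mu> * norm v * norm (z - ybar)) \<le> l z ybar + ereal (\<mu> * e)"
  shows "dual_diag A R l ybar \<mu> v \<le> dual_lim A R ybar v + ereal e"
proof -
  have "ereal (v \<bullet> z) - ereal (1 / \<mu>) * l z ybar \<le> ereal (ybar \<bullet> v + e)" for z
  proof (cases "l z ybar")
    case (real b)
    have "v \<bullet> (z - ybar) \<le> norm v * norm (z - ybar)" by (rule norm_cauchy_schwarz)
    also have "\<dots> \<le> b / \<mu> + e"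
      using bound[of z] \<open>0 < \<mu>\<close> by (simp add: real field_simps)
    finally show ?thesis by (simp add: real inner_diff_right inner_commute)
  qed (use nonneg[of z] \<open>0 < \<mu>\<close> in auto)
  then have "ereal (1 / \<mu>) * fenchel_conj (\<lambda>z. l z ybar) (\<mu> *\<^sub>R v) \<le> ereal (ybar \<bullet> v + e)"
    unfolding scaled_fenchel_conj[OF assms(1)] by (intro SUP_least)
  then have "fenchel_conj R (- adjoint A v) + ereal (1 / \<mu>) * fenchel_conj (\<lambda>z. l z ybar) (\<mu> *\<^sub>R v)
      \<le> fenchel_conj R (- adjoint A v) + ereal (ybar \<bullet> v + e)"
    by (rule add_left_mono)
  then show ?thesis
    by (simp add: dual_lim_def dual_diag_def add.assoc)
qed

section \<open>The Lyapunov estimate\<close>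

text \<open>In the application \<open>D(t)\<close> is \<open>d_lam(t) (u t) - inf d_0\<close>, and \<open>\<xi>\<close> is a subgradient of \<open>d_lam(t)\<close> at
  \<open>u t\<close>. As \<open>d_lam(s) \<ge> d_lam(t)\<close> only holds for \<open>s \<le> t\<close>, the lower bound on \<open>D\<close> is one-sided.\<close>

lemma inertial_lyapunov_bound:
  fixes u u' :: "real \<Rightarrow> 'a::real_inner" and D e :: "real \<Rightarrow> real" and u0 :: 'a
  assumes t0: "0 < t0" and \<alpha>: "3 \<le> \<alpha>"
    and du: "\<And>t. t0 \<le> t \<Longrightarrow> (u has_vector_derivative u' t) (at t within {t0..})"
    and u'_cont: "continuous_on {t0..} u'"
    and u'_ac: "\<And>T. t0 < T \<Longrightarrow> abs_continuous_on t0 T u'"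
    and D_ac: "\<And>T. t0 < T \<Longrightarrow> abs_continuous_on t0 T D"
    and D_nonneg: "\<And>t. t0 \<le> t \<Longrightarrow> 0 \<le> D t"
    and e_cont: "continuous_on {t0..} e" and e_nonneg: "\<And>t. t0 \<le> t \<Longrightarrow> 0 \<le> e t"
    and e_int: "(\<lambda>t. t * e t) integrable_on {t0..}"
    and AE: "AE t in lborel. t0 \<le> t \<longrightarrow> (\<exists>u'' \<xi>.
      (u' has_vector_derivative u'') (at t within {t0..}) \<and> u'' = - \<xi> - (\<alpha> / t) *\<^sub>R u' t \<and>
      (\<forall>s\<in>{t0..t}. D t + \<xi> \<bullet> (u s - u t) \<le> D s) \<and> D t + \<xi> \<bullet> (u0 - u t) \<le> e t)"
  obtains C where "0 < C" "\<And>t. t0 < t \<Longrightarrow> t\<^sup>2 * D t \<le> C"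
proof -
  \<comment> \<open>With this weight the damping cancels in the derivative of \<open>z\<close>,
    since \<open>\<beta> + 1 = \<alpha>\<close>; what is left is
    \<open>- t *\<^sub>R \<xi>\<close>.\<close>
  define \<beta> where "\<beta> = \<alpha> - 1"
  have \<beta>: "2 \<le> \<beta>" using \<alpha> by (simp add: \<beta>_def)
  define z where "z = (\<lambda>t. \<beta> *\<^sub>R (u t - u0) + t *\<^sub>R u' t)"
  define g where "g = (\<lambda>t. \<beta> *\<^sub>R (t * e t))"
  define G where "G = (\<lambda>t. integral {t0..t} g)"
  \<comment> \<open>The accumulated error \<open>G\<close> is subtracted so that \<open>F\<close>
    decreases. Writing \<open>t * t\<close> and an inner product lets the rules for bounded bilinear
    maps apply.\<close>
  define F where "F = (\<lambda>t. (t * t) * D t + ((1/2) * (z t \<bullet> z t) - G t))"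
  have g_cont: "continuous_on {t0..} g"
    unfolding g_def by (intro continuous_intros e_cont)
  have g_int: "g integrable_on {t0..}"
    unfolding g_def by (intro integrable_cmul e_int)
  have g_nonneg: "0 \<le> g t" if "t0 \<le> t" for t
    using that e_nonneg[OF that] t0 \<beta> by (simp add: g_def)
  have F_le: "F T \<le> F t0" if "t0 < T" for T
  proof -
    have dG: "(G has_vector_derivative g t) (at t within {t0..T})" if "t \<in> {t0..T}" for t
      unfolding G_def using that
      by (intro integral_has_vector_derivative continuous_on_subset[OF g_cont]) auto
    have u_ac: "abs_continuous_on t0 T u"
    proof (rule C1_imp_abs_continuous_on)
      show "(u has_vector_derivative u' t) (at t within {t0..T})" if "t \<in> {t0..T}" for t
        using du[of t] that by (auto intro: has_vector_derivative_within_subset)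
      show "continuous_on {t0..T} u'" using u'_cont by (rule continuous_on_subset) auto
    qed
    have G_ac: "abs_continuous_on t0 T G"
      using dG continuous_on_subset[OF g_cont] by (intro C1_imp_abs_continuous_on[of _ _ G g]) auto
    have z_ac: "abs_continuous_on t0 T z"
      unfolding z_def
      by (intro abs_continuous_on_add abs_continuous_on_diff abs_continuous_on_const
          bounded_bilinear.abs_continuous_on[OF bounded_bilinear_scaleR] abs_continuous_on_id
          u_ac u'_ac \<open>t0 < T\<close>)
    have F_ac: "abs_continuous_on t0 T F"
      unfolding F_def
      by (intro abs_continuous_on_add abs_continuous_on_diff abs_continuous_on_const
          bounded_bilinear.abs_continuous_on[OF bounded_bilinear_mult]
          bounded_bilinear.abs_continuous_on[OF bounded_bilinear_inner] abs_continuous_on_id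
          z_ac G_ac D_ac \<open>t0 < T\<close>)
    show ?thesis
    proof (rule abs_continuous_on_AE_left_decreasing[OF F_ac])
      show "AE t in lborel. t0 < t \<longrightarrow> t \<le> T \<longrightarrow>
        (\<forall>\<epsilon>>0. \<forall>\<^sub>F s in at_left t. F t - F s \<le> \<epsilon> * (t - s))"
        using AE
      proof eventually_elim
        case (elim t)
        show ?case
        proof (intro impI allI)
          fix \<epsilon> :: real assume t: "t0 < t" "t \<le> T" and "\<epsilon> > 0"
          obtain u'' \<xi> where du': "(u' has_vector_derivative u'') (at t within {t0..})"
            and u'': "u'' = - \<xi> - (\<alpha> / t) *\<^sub>R u' t"
            and lower: "\<And>s. s \<in> {t0..t} \<Longrightarrow> D t + \<xi> \<bullet> (u s - u t) \<le> D s"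
            and gap: "D t + \<xi> \<bullet> (u0 - u t) \<le> e t"
            using elim t by force
          \<comment> \<open>\<open>D\<close> is replaced by its minorant through the subgradient at
            \<open>t\<close>. \<open>H\<close> has a left derivative at \<open>t\<close>, equals
            \<open>F\<close> there and lies below \<open>F\<close> to the left, so
            \<open>F t - F s \<le> H t - H s\<close>.\<close>
          define H where "H = (\<lambda>s. (s * s) * (D t + \<xi> \<bullet> (u s - u t)) + ((1/2) * (z s \<bullet> z s) - G s))"
          have du_t: "(u has_vector_derivative u' t) (at t within {t0..t})"
            using du[of t] t by (auto intro: has_vector_derivative_within_subset)
          have du'_t: "(u' has_vector_derivative u'') (at t within {t0..t})"
            using du' by (rule has_vector_derivative_within_subset) auto
          have dG_t: "(G has_vector_derivative g t) (at t within {t0..t})"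
            using dG[of t] t by (auto intro: has_vector_derivative_within_subset)
          have "(z has_vector_derivative \<beta> *\<^sub>R (u' t - 0) + (t *\<^sub>R u'' + 1 *\<^sub>R u' t)) (at t within {t0..t})"
            unfolding z_def
            by (intro has_vector_derivative_add has_vector_derivative_diff has_vector_derivative_const
                bounded_linear.has_vector_derivative[OF bounded_linear_scaleR_right]
                bounded_bilinear.has_vector_derivative[OF bounded_bilinear_scaleR]
                has_vector_derivative_id du_t du'_t)
          moreover have "\<beta> *\<^sub>R (u' t - 0) + (t *\<^sub>R u'' + 1 *\<^sub>R u' t) = - t *\<^sub>R \<xi>"
            using t t0 by (simp add: u'' \<beta>_def scaleR_right_diff_distrib scaleR_left_diff_distrib)
          ultimately have dz: "(z has_vector_derivative - t *\<^sub>R \<xi>) (at t within {t0..t})" by simp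
          have "(H has_vector_derivative
              ((t * t) * (0 + \<xi> \<bullet> (u' t - 0)) + (t * 1 + 1 * t) * (D t + \<xi> \<bullet> (u t - u t)))
              + ((1/2) * (z t \<bullet> (- t *\<^sub>R \<xi>) + (- t *\<^sub>R \<xi>) \<bullet> z t) - g t)) (at t within {t0..t})"
            unfolding H_def
            by (intro has_vector_derivative_add has_vector_derivative_diff has_vector_derivative_const
                has_vector_derivative_mult has_vector_derivative_id dG_t du_t dz
                bounded_linear.has_vector_derivative[OF bounded_linear_inner_right]
                bounded_linear.has_vector_derivative[OF bounded_linear_mult_right]
                bounded_bilinear.has_vector_derivative[OF bounded_bilinear_inner])
          then obtain h where h: "(H has_real_derivative h) (at t within {t0..t})"
            and h_eq: "h = ((t * t) * (0 + \<xi> \<bullet> (u' t - 0)) + (t * 1 + 1 * t) * (D t + \<xi> \<bullet> (u t - u t)))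
              + ((1/2) * (z t \<bullet> (- t *\<^sub>R \<xi>) + (- t *\<^sub>R \<xi>) \<bullet> z t) - g t)"
            unfolding has_real_derivative_iff_has_vector_derivative by blast
          \<comment> \<open>The terms with \<open>\<xi> \<bullet> u' t\<close> from the dual gap and
            from \<open>z\<close> cancel.\<close>
          have "h = t * (2 * D t + \<beta> * (\<xi> \<bullet> (u0 - u t)) - \<beta> * e t)"
            by (simp add: h_eq z_def g_def inner_simps inner_commute[of _ \<xi>] algebra_simps)
          also have "\<dots> \<le> t * (2 * D t + \<beta> * (e t - D t) - \<beta> * e t)"
            using gap t t0 \<beta> by (intro mult_left_mono diff_right_mono add_left_mono) auto
          \<comment> \<open>The bound \<open>2 \<le> \<beta>\<close>, that is
            \<open>3 \<le> \<alpha>\<close>, gives the remaining multiple of \<open>D t\<close> the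
            right sign.\<close>
          also have "\<dots> = t * ((2 - \<beta>) * D t)" by (simp add: algebra_simps)
          also have "\<dots> \<le> 0"
            using t t0 \<beta> D_nonneg[of t] by (intro mult_nonneg_nonpos mult_nonpos_nonneg) auto
          finally have "h < \<epsilon>" using \<open>\<epsilon> > 0\<close> by simp
          have "((\<lambda>s. (H s - H t) / (s - t)) \<longlongrightarrow> h) (at_left t)"
            using h t by (simp add: has_field_derivative_iff at_within_Icc_at_left)
          then have "\<forall>\<^sub>F s in at_left t. (H s - H t) / (s - t) < \<epsilon>"
            using \<open>h < \<epsilon>\<close> by (rule order_tendstoD(2))
          moreover have "\<forall>\<^sub>F s in at_left t. s \<in> {t0<..<t}"
            using t by (intro eventually_at_left_real)
          ultimately show "\<forall>\<^sub>F s in at_left t. F t - F s \<le> \<epsilon> * (t - s)"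
          proof eventually_elim
            case (elim s)
            then have s: "t0 < s" "s < t" by auto
            have "H s - H t > \<epsilon> * (s - t)"
              using elim(1) s by (simp add: neg_divide_less_eq)
            moreover have "H t = F t" by (simp add: H_def F_def)
            moreover have "H s \<le> F s"
              using lower[of s] s by (auto simp: H_def F_def intro: mult_left_mono)
            ultimately show ?case by (simp add: right_diff_distrib)
          qed
        qed
      qed
    qed (use \<open>t0 < T\<close> in simp)
  qed
  have G_le: "G T \<le> integral {t0..} g" for T
    unfolding G_def
    by (intro integral_subset_le g_int integrable_continuous_real continuous_on_subset[OF g_cont])
      (auto intro: g_nonneg)
  define C where "C = \<bar>F t0\<bar> + \<bar>integral {t0..} g\<bar> + 1"
  have "t\<^sup>2 * D t \<le> C" if "t0 < t" for t
  proof -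
    have "0 \<le> z t \<bullet> z t" by simp
    then have "t\<^sup>2 * D t \<le> F t + G t" by (simp add: F_def power2_eq_square)
    then show ?thesis
      using F_le[OF that] G_le[of t] unfolding C_def by linarith
  qed
  moreover have "0 < C" by (simp add: C_def)
  ultimately show thesis by (rule that[rotated])
qed

theorem theorem3p3:
  fixes A :: "'x::{real_inner, complete_space} \<Rightarrow> 'y::{real_inner, complete_space}"
    and R :: "'x \<Rightarrow> ereal"
    and l :: "'y \<Rightarrow> 'y \<Rightarrow> ereal"
    and ybar udag :: 'y
    and xdag :: 'x
    and q \<gamma> \<sigma> \<alpha> t0 :: real
    and \<rho> :: ereal
    and lam :: "real \<Rightarrow> real"
    and x :: "real \<Rightarrow> 'x"
    and u :: "real \<Rightarrow> 'y"
  assumes A: "bounded_linear A"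
    and L1: "\<And>y. (\<lambda>z. l z y) \<in> Gamma0" "\<And>y. coercive_fun (\<lambda>z. l z y)"
    and L2: "\<And>y1 y2. l y1 y2 = 0 \<longleftrightarrow> y1 = y2"
    and L3: "1 \<le> q" "0 < \<rho>" "0 < \<gamma>"
      "\<And>y. ereal (dist y ybar) < \<rho> \<Longrightarrow> ereal (\<gamma> / q * norm (y - ybar) powr q) \<le> l y ybar"
    and R1: "0 < \<sigma>" "strongly_convex_fun \<sigma> R"
    and xdag: "xdag \<in> argmin_on R (argmin_on (\<lambda>x'. l (A x') ybar) UNIV)"
    and R2: "subdiff R xdag \<inter> range (adjoint A) \<noteq> {}"
    and t0: "0 < t0"
    and lam: "\<And>t. 0 \<le> t \<Longrightarrow> 0 < lam t" "antimono_on {0..} lam" "lam differentiable_on {0..}"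
      "(lam \<longlongrightarrow> 0) at_top"
      "1 < q \<Longrightarrow> set_integrable lborel {t0..} (\<lambda>t. t * lam t powr (1 / (q - 1)))"
    and udag: "udag \<in> argmin_on (dual_lim A R ybar) UNIV"
    and start: "ereal (lam t0 * norm udag) \<le> ereal (\<gamma> / q) * radius_pow \<rho> q"
    and \<alpha>: "3 \<le> \<alpha>"
    and sol: "inertial_dual_diagonal_solution A R l ybar lam \<alpha> t0 x u"
  shows "\<exists>C>0. \<forall>t>t0.
    dual_diag A R l ybar (lam t) (u t) - (INF v. dual_lim A R ybar v) \<le> ereal (C / t\<^sup>2) \<and>
    norm (x t - xdag) \<le> sqrt (2 * C) / (sqrt \<sigma> * t)"
proof -

  \<comment> \<open>Positivity of the data fit and monotonicity of the dual functions\<close>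
  define f where "f = (\<lambda>z. l z ybar)"
  define dd where "dd = (\<lambda>t. dual_diag A R l ybar (lam t))"
  define dl where "dl = dual_lim A R ybar"
  have conv: "convex_fun f" using L1(1) by (simp add: f_def Gamma0_def)
  have f0: "f ybar = 0" using L2 by (simp add: f_def)
  have growth: "\<And>y. ereal (dist y ybar) < \<rho> \<Longrightarrow> ereal (\<gamma> / q * norm (y - ybar) powr q) \<le> f y"
    unfolding f_def by (rule L3(4))
  have f_pos: "0 < f y" if "y \<noteq> ybar" for y
    using convex_fun_growth_pos[OF conv f0 _ L3(2) that growth] L3 by simp
  then have f_nonneg: "0 \<le> l y ybar" for y
    using f0 unfolding f_def by (cases "y = ybar") (auto intro: less_imp_le)
  obtain u' where du: "\<And>t. t0 \<le> t \<Longrightarrow> (u has_vector_derivative u' t) (at t within {t0..})"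
    and u'_cont: "continuous_on {t0..} u'"
    and grad: "\<And>t. t0 \<le> t \<Longrightarrow> has_gradient (fenchel_conj R) (- adjoint A (u t)) (x t)"
    and u'_ac: "\<And>T. t0 < T \<Longrightarrow> abs_continuous_on t0 T u'"
    and dd_fin: "\<And>t. t0 \<le> t \<Longrightarrow> \<bar>dd t (u t)\<bar> \<noteq> \<infinity>"
    and dd_ac: "\<And>T. t0 < T \<Longrightarrow> abs_continuous_on t0 T (\<lambda>t. real_of_ereal (dd t (u t)))"
    and incl: "AE t in lborel. t0 \<le> t \<longrightarrow>
      (\<exists>u''. (u' has_vector_derivative u'') (at t within {t0..}) \<and>
        - u'' - (\<alpha> / t) *\<^sub>R u' t \<in> subdiff (dd t) (u t))"
    using sol unfolding inertial_dual_diagonal_solution_def dd_def by blast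
  have lam_pos: "0 < lam t" if "t0 \<le> t" for t using lam(1) that t0 by simp
  have dl_le_dd: "dl v \<le> dd t v" if "t0 \<le> t" for t v
    unfolding dl_def dd_def using lam_pos[OF that] f0 by (intro dual_lim_le_dual_diag) (auto simp: f_def)
  have dd_antimono: "dd t v \<le> dd s v" if "t0 \<le> s" "s \<le> t" for s t v
    unfolding dd_def using lam_pos[of t] that t0
    by (intro dual_diag_mono f_nonneg monotone_onD[OF lam(2)]) auto

  \<comment> \<open>Dual optimal value and identification of the primal solution\<close>
  have dl_min: "dl udag \<le> dl v" for v
    using udag by (auto simp: argmin_on_def is_arg_min_def dl_def not_less)
  \<comment> \<open>The trajectory supplies a point where \<open>R\<close> is finite, which bounds
    the conjugate from below at \<open>udag\<close>; the upper bound is the finite dual value at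
    \<open>t0\<close>.\<close>
  obtain b0 where b0: "R (x t0) = ereal b0"
    using has_gradient_fenchel_conj[OF R1 grad[of t0]] by auto
  have dl_fin: "\<bar>dl udag\<bar> \<noteq> \<infinity>"
  proof -
    have "ereal ((- adjoint A udag) \<bullet> x t0) - R (x t0) \<le> fenchel_conj R (- adjoint A udag)"
      unfolding fenchel_conj_def by (rule SUP_upper2[of "x t0"]) auto
    then have "dl udag \<noteq> -\<infinity>"
      by (auto simp: dl_def dual_lim_def b0)
    moreover have "dl udag \<le> dd t0 (u t0)"
      using dl_min dl_le_dd order_trans by blast
    then have "dl udag \<noteq> \<infinity>" using dd_fin[of t0] by auto
    ultimately show ?thesis by auto
  qed
  obtain z a where Az: "A z = ybar" and Rz: "R z = ereal a" and dl_udag: "dl udag = ereal (- a)"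
    and R_growth: "\<forall>y. ereal (a - adjoint A udag \<bullet> (y - z) + \<sigma> / 2 * (norm (y - z))\<^sup>2) \<le> R y"
    using dual_lim_minimizer[OF A R1 dl_min[unfolded dl_def] dl_fin[unfolded dl_def]]
    unfolding dl_def by blast
  have inf_dl: "(INF v. dl v) = ereal (- a)"
    using dl_min dl_udag by (intro antisym INF_lower2[of udag] INF_greatest) auto
  have A_xdag: "A xdag = ybar" and R_xdag: "R xdag \<le> R z"
  proof -
    \<comment> \<open>\<open>z\<close> fits the data exactly, so it competes with
      \<open>xdag\<close> for the least \<open>R\<close>; conversely the data fit of
      \<open>xdag\<close> is at most that of \<open>z\<close>, which is \<open>0\<close>.\<close>
    have z_min: "z \<in> argmin_on (\<lambda>x'. l (A x') ybar) UNIV"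
      using f_nonneg f0 by (auto simp: argmin_on_def is_arg_min_def Az f_def not_less)
    then show "R xdag \<le> R z"
      using xdag unfolding argmin_on_def[of R] is_arg_min_def by (auto simp: not_less)
    have "f (A xdag) \<le> f (A z)"
      using xdag unfolding argmin_on_def is_arg_min_def f_def by (auto simp: not_less)
    then show "A xdag = ybar" using f_pos[of "A xdag"] f0 by (auto simp: Az not_less[symmetric])
  qed
  interpret A: bounded_linear A by fact
  have xdag_eq: "xdag = z"
  proof -
    \<comment> \<open>\<open>A\<close> takes the same value at both points, so the linear term of
      \<open>R_growth\<close> vanishes and only the squared distance is left.\<close>
    have "adjoint A udag \<bullet> (xdag - z) = 0"
      using inner_adjoint_Hilbert[OF A, of "xdag - z" udag]
      by (simp add: inner_commute A.diff Az A_xdag)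
    then have "ereal (a + \<sigma> / 2 * (norm (xdag - z))\<^sup>2) \<le> ereal a"
      using order_trans[OF R_growth[rule_format, of xdag] R_xdag] Rz by simp
    then show ?thesis using R1(1) by (simp add: mult_le_0_iff)
  qed
  \<comment> \<open>The growth of \<open>R\<close> around \<open>x t\<close> is tested at
    \<open>xdag\<close>; the value of the conjugate at its gradient turns the constants into
    \<open>dl (u t)\<close>.\<close>
  have primal_gap: "ereal (\<sigma> / 2 * (norm (x t - xdag))\<^sup>2) \<le> dl (u t) + ereal a" if t: "t0 \<le> t" for t
  proof -
    obtain b where b: "R (x t) = ereal b"
      "fenchel_conj R (- adjoint A (u t)) = ereal ((- adjoint A (u t)) \<bullet> x t - b)"
      "\<forall>y. ereal (b + (- adjoint A (u t)) \<bullet> (y - x t) + \<sigma> / 2 * (norm (y - x t))\<^sup>2) \<le> R y"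
      using has_gradient_fenchel_conj[OF R1 grad[OF t]] by blast
    have "adjoint A (u t) \<bullet> xdag = ybar \<bullet> u t"
      using inner_adjoint_Hilbert[OF A, of xdag "u t"] by (simp add: inner_commute A_xdag)
    then have "\<sigma> / 2 * (norm (x t - xdag))\<^sup>2 \<le> (- adjoint A (u t)) \<bullet> x t - b + ybar \<bullet> u t + a"
      using b(3)[rule_format, of xdag] Rz xdag_eq by (simp add: norm_minus_commute inner_diff_right)
    then show ?thesis by (simp add: dl_def dual_lim_def b(2))
  qed

  \<comment> \<open>Dual gap and error term for the Lyapunov estimate\<close>
  define D where "D = (\<lambda>t. real_of_ereal (dd t (u t)) + a)"
  have D: "dd t (u t) = ereal (D t - a)" if "t0 \<le> t" for t
    using dd_fin[OF that] by (auto simp: D_def ereal_real)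
  have D_nonneg: "0 \<le> D t" if "t0 \<le> t" for t
    using order_trans[OF dl_min dl_le_dd[OF that], of "u t"] D[OF that] by (simp add: dl_udag)
  have D_ac: "abs_continuous_on t0 T D" if "t0 < T" for T
    unfolding D_def by (intro abs_continuous_on_add abs_continuous_on_const dd_ac that)
  \<comment> \<open>\<open>K\<close> is the time-independent part of the growth error, which at
    slope \<open>lam t * norm udag\<close> equals \<open>lam t * e t\<close>; the leading
    \<open>lam t\<close> is removed by the division in the dual function.\<close>
  define K where "K = norm udag * (q * norm udag / \<gamma>) powr (1 / (q - 1))"
  define e where "e = (\<lambda>t. if q = 1 then 0 else K * lam t powr (1 / (q - 1)))"
  have K: "0 \<le> K" by (simp add: K_def)
  have e_nonneg: "0 \<le> e t" for t using K by (simp add: e_def)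
  have e_cont: "continuous_on {t0..} e"
  proof -
    have "continuous_on {t0..} lam"
      using differentiable_imp_continuous_on[OF lam(3)] by (rule continuous_on_subset) (use t0 in auto)
    then have "continuous_on {t0..} (\<lambda>t. K * lam t powr (1 / (q - 1)))"
      using lam_pos by (intro continuous_intros) force+
    then show ?thesis unfolding e_def by (cases "q = 1") auto
  qed
  have e_int: "(\<lambda>t. t * e t) integrable_on {t0..}"
  proof (cases "q = 1")
    case False
    then have "(\<lambda>t. K *\<^sub>R (t * lam t powr (1 / (q - 1)))) integrable_on {t0..}"
      using L3(1) by (intro integrable_cmul set_borel_integral_eq_integral(1) lam(5)) simp
    then show ?thesis using False by (simp add: e_def mult.left_commute)
  qed (simp add: e_def integrable_0)
  have dd_udag: "dd t udag \<le> ereal (e t - a)" if t: "t0 \<le> t" for t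
  proof -
    \<comment> \<open>Monotonicity of \<open>lam\<close> carries the smallness condition from
      \<open>t0\<close> to every later time.\<close>
    have "lam t \<le> lam t0" using t t0 by (intro monotone_onD[OF lam(2)]) auto
    then have "ereal (lam t * norm udag) \<le> ereal (lam t0 * norm udag)"
      by (simp add: mult_right_mono)
    then have small: "ereal (lam t * norm udag) \<le> ereal (\<gamma> / q) * radius_pow \<rho> q"
      using start by (rule order_trans)
    have err: "growth_error \<gamma> q (lam t * norm udag) = lam t * e t"
    proof -
      have "q * (lam t * norm udag) / \<gamma> = (q * norm udag / \<gamma>) * lam t" by simp
      then have "(q * (lam t * norm udag) / \<gamma>) powr (1 / (q - 1))
          = (q * norm udag / \<gamma>) powr (1 / (q - 1)) * lam t powr (1 / (q - 1))"
        using lam_pos[OF t] L3 by (simp only: powr_mult)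
      then show ?thesis by (simp add: growth_error_def e_def K_def)
    qed
    have "dd t udag \<le> dl udag + ereal (e t)"
      unfolding dd_def dl_def
    proof (rule dual_diag_le_dual_lim[where l = l, OF lam_pos[OF t] f_nonneg])
      show "ereal (lam t * norm udag * norm (y - ybar)) \<le> l y ybar + ereal (lam t * e t)" for y
        using linear_le_convex_growth[OF conv f0 L3(1-3) growth _ small, of y] lam_pos[OF t]
        by (simp add: err f_def)
    qed
    then show ?thesis by (simp add: dl_udag)
  qed
  have ae: "AE t in lborel. t0 \<le> t \<longrightarrow> (\<exists>u'' \<xi>.
      (u' has_vector_derivative u'') (at t within {t0..}) \<and> u'' = - \<xi> - (\<alpha> / t) *\<^sub>R u' t \<and>
      (\<forall>s\<in>{t0..t}. D t + \<xi> \<bullet> (u s - u t) \<le> D s) \<and> D t + \<xi> \<bullet> (udag - u t) \<le> e t)"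
    using incl
  proof eventually_elim
    case (elim t)
    show ?case
    proof
      assume t: "t0 \<le> t"
      then obtain u'' where u'': "(u' has_vector_derivative u'') (at t within {t0..})"
        "- u'' - (\<alpha> / t) *\<^sub>R u' t \<in> subdiff (dd t) (u t)" using elim by blast
      define \<xi> where "\<xi> = - u'' - (\<alpha> / t) *\<^sub>R u' t"
      have sub: "ereal (D t - a + \<xi> \<bullet> (v - u t)) \<le> dd t v" for v
        using u''(2) D[OF t] by (auto simp: subdiff_def \<xi>_def)
      \<comment> \<open>The subgradient inequality is evaluated at \<open>u s\<close> and followed
        by \<open>dd t (u s) \<le> dd s (u s)\<close>, valid for \<open>s \<le> t\<close>.\<close>
      have "D t + \<xi> \<bullet> (u s - u t) \<le> D s" if "s \<in> {t0..t}" for s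
        using order_trans[OF sub[of "u s"] dd_antimono[of s t "u s"]] D[of s] that by simp
      moreover have "D t + \<xi> \<bullet> (udag - u t) \<le> e t"
        using order_trans[OF sub[of udag] dd_udag[OF t]] by simp
      moreover have "u'' = - \<xi> - (\<alpha> / t) *\<^sub>R u' t" by (simp add: \<xi>_def)
      ultimately show "\<exists>u'' \<xi>.
          (u' has_vector_derivative u'') (at t within {t0..}) \<and> u'' = - \<xi> - (\<alpha> / t) *\<^sub>R u' t \<and>
          (\<forall>s\<in>{t0..t}. D t + \<xi> \<bullet> (u s - u t) \<le> D s) \<and> D t + \<xi> \<bullet> (udag - u t) \<le> e t"
        using u''(1) by blast
    qed
  qed

  \<comment> \<open>Convergence rates\<close>
  obtain C where C: "0 < C" "\<And>t. t0 < t \<Longrightarrow> t\<^sup>2 * D t \<le> C"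
    using inertial_lyapunov_bound[where u = u and u' = u' and D = D and e = e and ?u0.0 = udag,
        OF t0 \<alpha> du u'_cont u'_ac D_ac D_nonneg e_cont e_nonneg e_int ae] by blast
  have "dd t (u t) - (INF v. dl v) \<le> ereal (C / t\<^sup>2) \<and>
      norm (x t - xdag) \<le> sqrt (2 * C) / (sqrt \<sigma> * t)" if "t0 < t" for t
  proof -
    have t: "0 < t" "t0 \<le> t" using that t0 by auto
    have DC: "D t \<le> C / t\<^sup>2" using C(2)[OF that] t by (simp add: pos_le_divide_eq mult.commute)
    then have "dd t (u t) - (INF v. dl v) \<le> ereal (C / t\<^sup>2)"
      using D[OF t(2)] by (simp add: inf_dl)
    moreover have "norm (x t - xdag) \<le> sqrt (2 * C) / (sqrt \<sigma> * t)"
    proof -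
      have "dl (u t) + ereal a \<le> ereal (D t - a) + ereal a"
        using dl_le_dd[OF t(2), of "u t"] D[OF t(2)] by (intro add_right_mono) simp
      with primal_gap[OF t(2)] have "ereal (\<sigma> / 2 * (norm (x t - xdag))\<^sup>2) \<le> ereal (D t - a) + ereal a"
        by (rule order_trans)
      then have "\<sigma> / 2 * (norm (x t - xdag))\<^sup>2 \<le> D t" by simp
      also note DC
      finally have "\<sigma> / 2 * (norm (x t - xdag))\<^sup>2 \<le> C / t\<^sup>2" .
      then have "(norm (x t - xdag))\<^sup>2 \<le> 2 * C / (\<sigma> * t\<^sup>2)"
        using R1(1) t by (simp add: field_simps)
      then have "norm (x t - xdag) \<le> sqrt (2 * C / (\<sigma> * t\<^sup>2))" by (rule real_le_rsqrt)
      also have "\<dots> = sqrt (2 * C) / (sqrt \<sigma> * t)"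
        using t by (simp add: real_sqrt_divide real_sqrt_mult)
      finally show ?thesis .
    qed
    ultimately show ?thesis by blast
  qed
  then show ?thesis using C(1) unfolding dd_def dl_def by blast
qed

end
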